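(* Let $k\ge 2$ be a natural number. There is an algorithm which, given a $k$-automatic set $S$ of natural numbers, decides whether $S$ is an asymptotic additive basis (respectively, an additive basis) for $\mathbb{N}$ and finds the smallest number $j$, if it exists, such that $S$ is an asymptotic additive basis (respectively, an additive basis) of order $j$ for $\mathbb{N}$.
   Context: $\mathbb{N}$ denotes the set of natural numbers (including $0$). The canonical base-$k$ expansion of $n\in\mathbb{N}$ is the unique word over $\{0,1,\ldots,k-1\}$ representing $n$ in base $k$ without leading zeros. A set $S\subseteq\mathbb{N}$ is $k$-automatic if the language of canonical base-$k$ expansions of its elements is regular, i.e., accepted by a deterministic finite automaton (DFA); expansions are read by automata starting with the least significant digit. The set $S$ is given to the algorithm by such an automaton. $S$ is an additive basis (respectively, an asymptotic additive basis) of order $j$ for $\mathbb{N}$ if every natural number (respectively, every sufficiently large natural number) can be written as a sum of at most $j$ members of $S$. $S$ is an additive basis (respectively, an asymptotic additive basis) if it is one of order $j$ for some constant $j$. *)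

theory Defs
  imports Main "HOL-Library.Nat_Bijection"
begin

section \<open>Algorithms: general recursive functions\<close>

text \<open>
  \<open>general_recursive n f\<close> is Kleene's class of total recursive functions of arity \<open>n\<close>;
  minimisation is applied to regular functions only. Argument tuples are lists, and only
  the values of \<open>f\<close> on lists of length \<open>n\<close> are meaningful.
\<close>

inductive general_recursive :: "nat \<Rightarrow> (nat list \<Rightarrow> nat) \<Rightarrow> bool" where
  zero: "general_recursive n (\<lambda>xs. 0)"
| succ: "general_recursive 1 (\<lambda>xs. Suc (xs ! 0))"
| proj: "i < n \<Longrightarrow> general_recursive n (\<lambda>xs. xs ! i)"
| comp: "general_recursive (length fs) g \<Longrightarrow> (\<forall>f\<in>set fs. general_recursive n f) \<Longrightarrow>
    general_recursive n (\<lambda>xs. g (map (\<lambda>f. f xs) fs))"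
| prim_rec: "general_recursive n g \<Longrightarrow> general_recursive (Suc (Suc n)) h \<Longrightarrow>
    general_recursive (Suc n)
      (\<lambda>xs. rec_nat (g (tl xs)) (\<lambda>i r. h (i # r # tl xs)) (hd xs))"
| minimise: "general_recursive (Suc n) g \<Longrightarrow>
    (\<forall>xs. length xs = n \<longrightarrow> (\<exists>y. g (y # xs) = 0)) \<Longrightarrow>
    general_recursive n (\<lambda>xs. LEAST y. g (y # xs) = 0)"

definition computable :: "(nat \<Rightarrow> nat) \<Rightarrow> bool" where
  "computable f \<longleftrightarrow> (\<exists>g. general_recursive 1 g \<and> (\<forall>x. f x = g [x]))"


section \<open>Finite automata as finite objects\<close>

text \<open>
  The states are \<open>0, \<dots>, length (table M) - 1\<close>; row \<open>q\<close> of the table lists the successors of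
  state \<open>q\<close> on the digits \<open>0, \<dots>, k - 1\<close>.
\<close>

datatype dfa = DFA (start: nat) (table: "nat list list") (finals: "nat list")

definition wf_dfa :: "nat \<Rightarrow> dfa \<Rightarrow> bool" where
  "wf_dfa k M \<longleftrightarrow>
     start M < length (table M) \<and>
     (\<forall>row\<in>set (table M). length row = k \<and> set row \<subseteq> {..<length (table M)}) \<and>
     set (finals M) \<subseteq> {..<length (table M)}"

definition run :: "dfa \<Rightarrow> nat list \<Rightarrow> nat" where
  "run M w = foldl (\<lambda>q a. table M ! q ! a) (start M) w"

definition language :: "nat \<Rightarrow> dfa \<Rightarrow> nat list set" where
  "language k M = {w. set w \<subseteq> {..<k} \<and> run M w \<in> set (finals M)}"

definition encode_dfa :: "dfa \<Rightarrow> nat" where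
  "encode_dfa M =
     list_encode [start M, list_encode (map list_encode (table M)), list_encode (finals M)]"


section \<open>Automatic sets\<close>

text \<open>
  Words are written least significant digit first, so leading zeros of an expansion are at
  the end of the list; the canonical expansion of \<open>0\<close> is the empty word.
\<close>

definition canonical_expansion :: "nat \<Rightarrow> nat \<Rightarrow> nat list \<Rightarrow> bool" where
  "canonical_expansion k n w \<longleftrightarrow>
     set w \<subseteq> {..<k} \<and> horner_sum id k w = n \<and> (w \<noteq> [] \<longrightarrow> last w \<noteq> 0)"

definition accepts_set :: "nat \<Rightarrow> dfa \<Rightarrow> nat set \<Rightarrow> bool" where
  "accepts_set k M S \<longleftrightarrow>
     wf_dfa k M \<and> language k M = {w. \<exists>n\<in>S. canonical_expansion k n w}"


section \<open>Additive bases\<close>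

definition sum_of_at_most :: "nat \<Rightarrow> nat set \<Rightarrow> nat \<Rightarrow> bool" where
  "sum_of_at_most j S n \<longleftrightarrow> (\<exists>xs. length xs \<le> j \<and> set xs \<subseteq> S \<and> sum_list xs = n)"

definition additive_basis_of_order :: "nat \<Rightarrow> nat set \<Rightarrow> bool" where
  "additive_basis_of_order j S \<longleftrightarrow> (\<forall>n. sum_of_at_most j S n)"

definition additive_basis :: "nat set \<Rightarrow> bool" where
  "additive_basis S \<longleftrightarrow> (\<exists>j. additive_basis_of_order j S)"

definition asymptotic_additive_basis_of_order :: "nat \<Rightarrow> nat set \<Rightarrow> bool" where
  "asymptotic_additive_basis_of_order j S \<longleftrightarrow> (\<exists>N. \<forall>n\<ge>N. sum_of_at_most j S n)"

definition asymptotic_additive_basis :: "nat set \<Rightarrow> bool" where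
  "asymptotic_additive_basis S \<longleftrightarrow> (\<exists>j. asymptotic_additive_basis_of_order j S)"

end

theory Submission
  imports Defs "HOL-Library.FuncSet"
begin

text \<open>
  If some useful state of the automaton lies on two loops that start with different digits, then
  \<open>S\<close> contains, for every \<open>n\<close>, all numbers whose \<open>n\<close> middle digits in some base \<open>B\<close> are chosen
  freely from two digits. Sums of \<open>B - 1\<close> of these form an arithmetic progression of length
  \<open>B ^ n\<close>, so boundedly many summands reach all large numbers of one residue class, and all large
  numbers if the elements of \<open>S\<close> have no common divisor. Without such a state, the number of
  elements of \<open>S\<close> with \<open>l\<close> digits is polynomial in \<open>l\<close>, and \<open>S\<close> is not an asymptotic basis.

  For fixed \<open>j\<close>, the set of sums of at most \<open>j\<close> elements has a finite \<open>k\<close>-kernel of computable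
  size, so by pumping it is cofinite (or everything) as soon as it contains all numbers of an
  explicit finite interval. Hence it is decidable whether \<open>S\<close> has order \<open>j\<close>, and the least \<open>j\<close>
  is found by a search that is stopped by a certificate that \<open>S\<close> is not a basis.
\<close>

section \<open>Closure properties of general recursive functions\<close>

text \<open>A minimisation has to succeed on every input, so the search cannot look for an order
  alone: it looks for the least \<open>y\<close> that is an order or witnesses that none exists. The
  witnesses must be decidable one by one and must exist exactly when there is no order. For
  asymptotic bases, any \<open>y\<close> serves if the automaton does not branch, and otherwise
  \<open>y \<ge> 2\<close> must divide all elements of \<open>S\<close>; for additive bases the
  second case becomes \<open>1 \<notin> S\<close>. Thus neither the order nor the divisor needs an a
  priori bound. No automaton for the sums of \<open>j\<close> elements is ever constructed. The
  families of residual sets live in the proof only; the algorithm computes a bound on their size and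
  tests single numbers by running through all tuples of summands. Digits are obtained by division
  rather than from words, so that recursiveness of every test reduces to arithmetic and bounded
  quantification.\<close>

definition rec_fun :: "nat \<Rightarrow> (nat list \<Rightarrow> nat) \<Rightarrow> bool" where
  "rec_fun n f \<longleftrightarrow> (\<exists>g. general_recursive n g \<and> (\<forall>xs. length xs = n \<longrightarrow> f xs = g xs))"

definition dec_pred :: "nat \<Rightarrow> (nat list \<Rightarrow> bool) \<Rightarrow> bool" where
  "dec_pred n P \<longleftrightarrow> rec_fun n (\<lambda>xs. of_bool (P xs))"

text \<open>The rules of \<open>general_recursive\<close> yield particular lambda terms, also on
  lists of the wrong length. Passing to equality on lists of length \<open>n\<close> allows any
  convenient term for a function.\<close>

lemma rec_fun_cong:
  "rec_fun n f \<Longrightarrow> (\<And>xs. length xs = n \<Longrightarrow> f xs = g xs) \<Longrightarrow> rec_fun n g"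
  unfolding rec_fun_def by metis

lemma rec_fun_nth: "i < n \<Longrightarrow> rec_fun n (\<lambda>xs. xs ! i)"
  unfolding rec_fun_def using general_recursive.proj by blast

lemma rec_fun_hd: "rec_fun (Suc n) hd"
  by (rule rec_fun_cong[OF rec_fun_nth[of 0]]) (auto simp: hd_conv_nth neq_Nil_conv length_Suc_conv)

lemma rec_fun_comp:
  assumes "rec_fun (length fs) g" "\<And>f. f \<in> set fs \<Longrightarrow> rec_fun n f"
  shows "rec_fun n (\<lambda>xs. g (map (\<lambda>f. f xs) fs))"
proof -
  obtain g' where g': "general_recursive (length fs) g'"
    "\<And>xs. length xs = length fs \<Longrightarrow> g xs = g' xs"
    using assms(1) unfolding rec_fun_def by blast
  obtain r where r: "\<And>f. f \<in> set fs \<Longrightarrow> general_recursive n (r f) \<and> (\<forall>xs. length xs = n \<longrightarrow> f xs = r f xs)"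
    using assms(2) unfolding rec_fun_def by metis
  have "general_recursive n (\<lambda>xs. g' (map (\<lambda>f. f xs) (map r fs)))"
    by (rule general_recursive.comp) (use g' r in auto)
  moreover have "g (map (\<lambda>f. f xs) fs) = g' (map (\<lambda>f. f xs) (map r fs))" if "length xs = n" for xs
  proof -
    have "map (\<lambda>f. f xs) fs = map (\<lambda>f. f xs) (map r fs)"
      using r that by auto
    then show ?thesis using g'(2)[of "map (\<lambda>f. f xs) fs"] by (metis length_map)
  qed
  ultimately show ?thesis unfolding rec_fun_def by blast
qed

lemma rec_fun_Suc: "rec_fun n f \<Longrightarrow> rec_fun n (\<lambda>xs. Suc (f xs))"
proof -
  assume f: "rec_fun n f"
  have "rec_fun (length [f]) (\<lambda>xs. Suc (xs ! 0))"
    unfolding rec_fun_def using general_recursive.succ by auto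
  from rec_fun_comp[OF this, of n] f show ?thesis by simp
qed

lemma rec_fun_const: "rec_fun n (\<lambda>xs. c)"
proof (induction c)
  case 0
  show ?case unfolding rec_fun_def using general_recursive.zero by blast
next
  case (Suc c)
  then show ?case by (rule rec_fun_Suc)
qed

lemma rec_fun_reindex:
  assumes "rec_fun (length js) f" "set js \<subseteq> {..<n}"
  shows "rec_fun n (\<lambda>xs. f (map (\<lambda>j. xs ! j) js))"
proof -
  have "rec_fun n (\<lambda>xs. f (map (\<lambda>h. h xs) (map (\<lambda>j xs. xs ! j) js)))"
    by (rule rec_fun_comp) (use assms rec_fun_nth in auto)
  then show ?thesis by (simp add: comp_def)
qed

lemma map_nth_tl: "length xs = Suc n \<Longrightarrow> map (\<lambda>j. xs ! j) (map Suc [0..<n]) = tl xs"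
  by (rule nth_equalityI) (auto simp: nth_tl)

lemma rec_fun_tl: "rec_fun n f \<Longrightarrow> rec_fun (Suc n) (\<lambda>xs. f (tl xs))"
proof -
  assume f: "rec_fun n f"
  have "rec_fun (Suc n) (\<lambda>xs. f (map (\<lambda>j. xs ! j) (map Suc [0..<n])))"
    by (rule rec_fun_reindex) (use f in auto)
  then show ?thesis by (rule rec_fun_cong) (simp only: map_nth_tl)
qed

text \<open>Serves bounded sums: the step function of a recursion receives the accumulator as its
  second argument, which the summand must ignore.\<close>

lemma rec_fun_drop_second:
  "rec_fun (Suc n) f \<Longrightarrow> rec_fun (Suc (Suc n)) (\<lambda>xs. f (hd xs # tl (tl xs)))"
proof -
  assume f: "rec_fun (Suc n) f"
  have *: "rec_fun (Suc (Suc n)) (\<lambda>xs. f (map (\<lambda>j. xs ! j) (0 # map Suc (map Suc [0..<n]))))"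
    by (rule rec_fun_reindex) (use f in auto)
  have "f (map (\<lambda>j. xs ! j) (0 # map Suc (map Suc [0..<n]))) = f (hd xs # tl (tl xs))"
    if "length xs = Suc (Suc n)" for xs
    using that
    by (intro arg_cong[of _ _ f] nth_equalityI) (auto simp: nth_Cons nth_tl length_Suc_conv split: nat.split)
  with * show ?thesis by (rule rec_fun_cong)
qed

lemma rec_fun_rec_nat:
  assumes b: "rec_fun n b" and g: "rec_fun n g"
    and h: "rec_fun (Suc (Suc n)) (\<lambda>ys. h (hd ys) (hd (tl ys)) (tl (tl ys)))"
  shows "rec_fun n (\<lambda>xs. rec_nat (g xs) (\<lambda>i r. h i r xs) (b xs))"
proof -
  obtain g' where g': "general_recursive n g'" "\<And>xs. length xs = n \<Longrightarrow> g xs = g' xs"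
    using g unfolding rec_fun_def by blast
  obtain h' where h': "general_recursive (Suc (Suc n)) h'"
    "\<And>xs. length xs = Suc (Suc n) \<Longrightarrow> h (hd xs) (hd (tl xs)) (tl (tl xs)) = h' xs"
    using h unfolding rec_fun_def by blast
  let ?P = "\<lambda>xs. rec_nat (g' (tl xs)) (\<lambda>i r. h' (i # r # tl xs)) (hd xs)"
  have P: "rec_fun (Suc n) ?P"
    unfolding rec_fun_def using general_recursive.prim_rec[OF g'(1) h'(1)] by blast
  \<comment> \<open>Evaluation at \<open>b xs # xs\<close> turns the recursion argument of Kleene's
    scheme into a computed bound.\<close>
  let ?fs = "b # map (\<lambda>j xs. xs ! j) [0..<n]"
  have "rec_fun n (\<lambda>xs. ?P (map (\<lambda>f. f xs) ?fs))"
    by (rule rec_fun_comp) (use P b rec_fun_nth in auto)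
  then show ?thesis
  proof (rule rec_fun_cong)
    fix xs :: "nat list" assume l: "length xs = n"
    have "map (\<lambda>j. xs ! j) [0..<n] = xs" using l map_nth by blast
    then have *: "?P (map (\<lambda>f. f xs) ?fs) = rec_nat (g' xs) (\<lambda>i r. h' (i # r # xs)) (b xs)"
      by (simp add: comp_def)
    have "(\<lambda>i r. h' (i # r # xs)) = (\<lambda>i r. h i r xs)"
      using h'(2)[of "_ # _ # xs"] l by (intro ext) simp
    then show "?P (map (\<lambda>f. f xs) ?fs) = rec_nat (g xs) (\<lambda>i r. h i r xs) (b xs)"
      using * g'(2)[OF l] by simp
  qed
qed

section \<open>Recursive arithmetic, decidable predicates and minimisation\<close>

named_theorems rec_intros

lemmas [rec_intros] = rec_fun_const rec_fun_hd rec_fun_Suc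

lemma rec_fun_add [rec_intros]:
  assumes "rec_fun n f" "rec_fun n g"
  shows "rec_fun n (\<lambda>xs. f xs + g xs)"
proof -
  have "rec_fun n (\<lambda>xs. rec_nat (f xs) (\<lambda>i r. Suc r) (g xs))"
    by (intro rec_fun_rec_nat rec_fun_Suc rec_fun_tl rec_fun_hd assms)
  moreover have "rec_nat x (\<lambda>i r. Suc r) y = x + y" for x y :: nat by (induction y) auto
  ultimately show ?thesis by simp
qed

lemma rec_fun_mult [rec_intros]:
  assumes "rec_fun n f" "rec_fun n g"
  shows "rec_fun n (\<lambda>xs. f xs * g xs)"
proof -
  have "rec_fun n (\<lambda>xs. rec_nat 0 (\<lambda>i r. r + f xs) (g xs))"
    by (intro rec_fun_rec_nat rec_fun_const rec_fun_add rec_fun_tl rec_fun_hd assms)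
  moreover have "rec_nat 0 (\<lambda>i r. r + x) y = x * y" for x y :: nat by (induction y) auto
  ultimately show ?thesis by simp
qed

lemma rec_fun_power [rec_intros]:
  assumes "rec_fun n f" "rec_fun n g"
  shows "rec_fun n (\<lambda>xs. f xs ^ g xs)"
proof -
  have "rec_fun n (\<lambda>xs. rec_nat 1 (\<lambda>i r. r * f xs) (g xs))"
    by (intro rec_fun_rec_nat rec_fun_const rec_fun_mult rec_fun_tl rec_fun_hd assms)
  moreover have "rec_nat 1 (\<lambda>i r. r * x) y = x ^ y" for x y :: nat by (induction y) auto
  ultimately show ?thesis by simp
qed

lemma rec_fun_diff [rec_intros]:
  assumes "rec_fun n f" "rec_fun n g"
  shows "rec_fun n (\<lambda>xs. f xs - g xs)"
proof -
  have pred: "rec_fun m (\<lambda>xs. h xs - 1)" if "rec_fun m h" for m h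
  proof -
    have "rec_fun m (\<lambda>xs. rec_nat 0 (\<lambda>i r. i) (h xs))"
      by (intro rec_fun_rec_nat rec_fun_const rec_fun_hd that)
    moreover have "rec_nat 0 (\<lambda>i r. i) y = y - 1" for y :: nat by (cases y) auto
    ultimately show ?thesis by simp
  qed
  have "rec_fun n (\<lambda>xs. rec_nat (f xs) (\<lambda>i r. r - 1) (g xs))"
    by (intro rec_fun_rec_nat pred rec_fun_tl rec_fun_hd assms)
  moreover have "rec_nat x (\<lambda>i r. r - 1) y = x - y" for x y :: nat by (induction y) auto
  ultimately show ?thesis by simp
qed

lemma rec_fun_sum [rec_intros]:
  assumes b: "rec_fun n b" and f: "rec_fun (Suc n) (\<lambda>ys. f (hd ys) (tl ys))"
  shows "rec_fun n (\<lambda>xs. \<Sum>i<b xs. f i xs)"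
proof -
  have "rec_fun n (\<lambda>xs. rec_nat 0 (\<lambda>i r. r + f i xs) (b xs))"
  proof (intro rec_fun_rec_nat rec_fun_const rec_fun_add rec_fun_tl rec_fun_hd b)
    show "rec_fun (Suc (Suc n)) (\<lambda>ys. f (hd ys) (tl (tl ys)))"
      using rec_fun_drop_second[OF f] by simp
  qed
  moreover have "rec_nat 0 (\<lambda>i r. r + f i xs) y = (\<Sum>i<y. f i xs)" for y xs by (induction y) auto
  ultimately show ?thesis by simp
qed

lemma rec_fun_of_bool [rec_intros]: "dec_pred n P \<Longrightarrow> rec_fun n (\<lambda>xs. of_bool (P xs))"
  by (simp add: dec_pred_def)

lemma dec_pred_not [rec_intros]: "dec_pred n P \<Longrightarrow> dec_pred n (\<lambda>xs. \<not> P xs)"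
  unfolding dec_pred_def
  by (rule rec_fun_cong[of _ "\<lambda>xs. 1 - of_bool (P xs)"]) (auto intro: rec_intros)

lemma dec_pred_conj [rec_intros]:
  "dec_pred n P \<Longrightarrow> dec_pred n Q \<Longrightarrow> dec_pred n (\<lambda>xs. P xs \<and> Q xs)"
  unfolding dec_pred_def
  by (rule rec_fun_cong[of _ "\<lambda>xs. of_bool (P xs) * of_bool (Q xs)"]) (auto intro: rec_intros)

lemma dec_pred_disj [rec_intros]:
  assumes "dec_pred n P" "dec_pred n Q" shows "dec_pred n (\<lambda>xs. P xs \<or> Q xs)"
proof -
  have "dec_pred n (\<lambda>xs. \<not> (\<not> P xs \<and> \<not> Q xs))" by (intro rec_intros assms)
  then show ?thesis by simp
qed

lemma dec_pred_imp [rec_intros]: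
  assumes "dec_pred n P" "dec_pred n Q" shows "dec_pred n (\<lambda>xs. P xs \<longrightarrow> Q xs)"
proof -
  have "dec_pred n (\<lambda>xs. \<not> P xs \<or> Q xs)" by (intro rec_intros assms)
  then show ?thesis by (simp only: imp_conv_disj)
qed

lemma dec_pred_le [rec_intros]:
  "rec_fun n f \<Longrightarrow> rec_fun n g \<Longrightarrow> dec_pred n (\<lambda>xs. f xs \<le> g xs)"
  unfolding dec_pred_def
  by (rule rec_fun_cong[of _ "\<lambda>xs. 1 - (f xs - g xs)"]) (auto intro: rec_intros)

lemma dec_pred_less [rec_intros]:
  assumes "rec_fun n f" "rec_fun n g" shows "dec_pred n (\<lambda>xs. f xs < g xs)"
proof -
  have "dec_pred n (\<lambda>xs. Suc (f xs) \<le> g xs)"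
    by (intro dec_pred_le rec_fun_Suc assms)
  then show ?thesis by (simp add: Suc_le_eq)
qed

lemma dec_pred_eq [rec_intros]:
  assumes "rec_fun n f" "rec_fun n g" shows "dec_pred n (\<lambda>xs. f xs = g xs)"
proof -
  have "dec_pred n (\<lambda>xs. f xs \<le> g xs \<and> g xs \<le> f xs)"
    by (intro dec_pred_conj dec_pred_le assms)
  then show ?thesis by (simp add: order_eq_iff[of "f _" "g _"])
qed

lemma dec_pred_ex [rec_intros]:
  assumes b: "rec_fun n b" and P: "dec_pred (Suc n) (\<lambda>ys. P (hd ys) (tl ys))"
  shows "dec_pred n (\<lambda>xs. \<exists>i<b xs. P i xs)"
proof -
  have "dec_pred n (\<lambda>xs. 0 < (\<Sum>i<b xs. of_bool (P i xs) :: nat))"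
    by (intro dec_pred_less rec_fun_const rec_fun_sum rec_fun_of_bool b P)
  moreover have "0 < (\<Sum>i<b xs. of_bool (P i xs) :: nat) \<longleftrightarrow> (\<exists>i<b xs. P i xs)" for xs
    by (auto simp: zero_less_iff_neq_zero)
  ultimately show ?thesis by simp
qed

lemma dec_pred_all [rec_intros]:
  assumes b: "rec_fun n b" and P: "dec_pred (Suc n) (\<lambda>ys. P (hd ys) (tl ys))"
  shows "dec_pred n (\<lambda>xs. \<forall>i<b xs. P i xs)"
proof -
  have "dec_pred n (\<lambda>xs. \<not> (\<exists>i<b xs. \<not> P i xs))"
    by (intro rec_intros b P)
  then show ?thesis by simp
qed

lemma rec_fun_if [rec_intros]:
  assumes "dec_pred n P" "rec_fun n f" "rec_fun n g"
  shows "rec_fun n (\<lambda>xs. if P xs then f xs else g xs)"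
  by (rule rec_fun_cong[of _ "\<lambda>xs. of_bool (P xs) * f xs + of_bool (\<not> P xs) * g xs"])
    (auto intro!: rec_intros assms)

text \<open>The existence assumption is the regularity demanded by \<open>minimise\<close>; every
  later unbounded search has to justify it.\<close>

lemma rec_fun_Least:
  assumes P: "dec_pred (Suc n) (\<lambda>ys. P (hd ys) (tl ys))" and ex: "\<And>xs. length xs = n \<Longrightarrow> \<exists>y. P y xs"
  shows "rec_fun n (\<lambda>xs. LEAST y. P y xs)"
proof -
  have "rec_fun (Suc n) (\<lambda>ys. of_bool (\<not> P (hd ys) (tl ys)))"
    by (intro rec_intros P)
  then obtain g where g: "general_recursive (Suc n) g"
    "\<And>ys. length ys = Suc n \<Longrightarrow> of_bool (\<not> P (hd ys) (tl ys)) = g ys"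
    unfolding rec_fun_def by blast
  have eq: "g (y # xs) = 0 \<longleftrightarrow> P y xs" if "length xs = n" for y xs
    using g(2)[of "y # xs"] that by (simp split: if_splits add: of_bool_def)
  have "general_recursive n (\<lambda>xs. LEAST y. g (y # xs) = 0)"
    by (rule general_recursive.minimise[OF g(1)]) (use eq ex in auto)
  then show ?thesis unfolding rec_fun_def using eq by (intro exI conjI) auto
qed

lemma rec_fun_div [rec_intros]:
  assumes "rec_fun n f" "rec_fun n g"
  shows "rec_fun n (\<lambda>xs. f xs div g xs)"
proof -
  \<comment> \<open>The disjunct \<open>y = 0\<close> keeps the search total and returns the
    conventional value \<open>x div 0 = 0\<close>.\<close>
  have eq: "x div y = (LEAST z. y = 0 \<or> x < Suc z * y)" for x y :: nat
  proof (cases "y = 0")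
    case False
    then show ?thesis
      using dividend_less_times_div[of y x] less_mult_imp_div_less[of x _ y]
      by (intro Least_equality[symmetric]) (auto simp: algebra_simps less_Suc_eq_le[symmetric])
  qed auto
  have "rec_fun n (\<lambda>xs. LEAST z. g xs = 0 \<or> f xs < Suc z * g xs)"
  proof (rule rec_fun_Least)
    show "dec_pred (Suc n) (\<lambda>ys. g (tl ys) = 0 \<or> f (tl ys) < Suc (hd ys) * g (tl ys))"
      by (intro rec_intros rec_fun_tl assms)
    show "\<exists>y. g xs = 0 \<or> f xs < Suc y * g xs" for xs
      by (rule exI[of _ "f xs"]) (cases "g xs", auto)
  qed
  then show ?thesis by (simp only: eq)
qed

lemma rec_fun_mod [rec_intros]:
  assumes "rec_fun n f" "rec_fun n g"
  shows "rec_fun n (\<lambda>xs. f xs mod g xs)"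
proof -
  have "rec_fun n (\<lambda>xs. f xs - g xs * (f xs div g xs))" by (intro rec_intros assms)
  then show ?thesis by (simp add: minus_mult_div_eq_mod)
qed

lemma dec_pred_dvd [rec_intros]:
  assumes "rec_fun n f" "rec_fun n g"
  shows "dec_pred n (\<lambda>xs. f xs dvd g xs)"
  unfolding dvd_eq_mod_eq_0 by (intro rec_intros assms)

lemma computableI:
  assumes "rec_fun (Suc 0) (\<lambda>xs. f (hd xs))" shows "computable f"
  using assms unfolding rec_fun_def computable_def
  by (metis One_nat_def length_Cons list.sel(1) list.size(3))

section \<open>Automata reading digits\<close>

text \<open>A number \<open>n\<close> together with a length \<open>l\<close> plays the role of a
  word: the \<open>l\<close> lowest digits of \<open>n\<close>, padded with zeros if
  necessary.\<close>

definition steps :: "nat \<Rightarrow> (nat \<Rightarrow> nat \<Rightarrow> nat) \<Rightarrow> nat \<Rightarrow> nat \<Rightarrow> nat \<Rightarrow> nat" where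
  "steps k d q n l = rec_nat q (\<lambda>i r. d r (n div k ^ i mod k)) l"

text \<open>Gives \<open>0\<close> for the number \<open>0\<close>, in accordance with its empty
  canonical expansion.\<close>

definition ndigits :: "nat \<Rightarrow> nat \<Rightarrow> nat" where
  "ndigits k n = (LEAST l. n < k ^ l)"

definition accepted :: "nat \<Rightarrow> (nat \<Rightarrow> nat \<Rightarrow> nat) \<Rightarrow> (nat \<Rightarrow> bool) \<Rightarrow> nat \<Rightarrow> nat set" where
  "accepted k d F q = {n. F (steps k d q n (ndigits k n))}"

lemma steps_0 [simp]: "steps k d q n 0 = q"
  by (simp add: steps_def)

lemma steps_Suc: "steps k d q n (Suc l) = d (steps k d q n l) (n div k ^ l mod k)"
  by (simp add: steps_def)

lemma steps_front: "steps k d q n (Suc l) = steps k d (d q (n mod k)) (n div k) l"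
proof (induction l)
  case (Suc l)
  have "n div k ^ Suc l = n div k div k ^ l" by (simp add: div_mult2_eq)
  then show ?case using Suc by (simp only: steps_Suc[of _ _ _ _ "Suc l"] steps_Suc[of _ _ _ _ l])
qed (simp add: steps_Suc)

locale digit_automaton =
  fixes k s :: nat and d :: "nat \<Rightarrow> nat \<Rightarrow> nat" and F :: "nat \<Rightarrow> bool"
  assumes k: "k \<ge> 2" and step_less: "\<And>q a. q < s \<Longrightarrow> a < k \<Longrightarrow> d q a < s"
begin

abbreviation "st \<equiv> steps k d"
abbreviation "acc \<equiv> accepted k d F"

lemma steps_append:
  "w < k ^ l \<Longrightarrow> st q (w + k ^ l * v) (l + m) = st (st q w l) v m"
proof (induction l arbitrary: q w)
  case (Suc l)
  have e: "w + k ^ Suc l * v = w + k * (k ^ l * v)" by simp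
  have "(w + k ^ Suc l * v) mod k = w mod k" by (simp only: e mod_mult_self2)
  moreover have "(w + k ^ Suc l * v) div k = w div k + k ^ l * v"
    unfolding e using k by (subst div_mult_self2) auto
  moreover have "w div k < k ^ l"
    using Suc.prems k by (simp add: div_less_iff_less_mult mult.commute)
  ultimately show ?case by (simp only: add_Suc steps_front Suc.IH)
qed simp

lemma steps_less: "q < s \<Longrightarrow> st q n l < s"
  using k by (induction l) (auto simp: steps_Suc step_less)

lemma ex_power_greater: "\<exists>l. n < k ^ l"
  using k by (intro exI[of _ n] power_gt_expt) simp

lemma ndigits_le_iff: "ndigits k n \<le> l \<longleftrightarrow> n < k ^ l"
proof
  assume "ndigits k n \<le> l"
  have "n < k ^ ndigits k n" unfolding ndigits_def using ex_power_greater by (rule LeastI_ex)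
  also have "\<dots> \<le> k ^ l" using k \<open>ndigits k n \<le> l\<close> by (simp add: power_increasing)
  finally show "n < k ^ l" .
qed (simp add: ndigits_def Least_le)

lemma ndigits_0 [simp]: "ndigits k 0 = 0"
  using ndigits_le_iff[of 0 0] by simp

lemma ndigits_pos: "n > 0 \<Longrightarrow> ndigits k n = Suc (ndigits k (n div k))"
proof (rule antisym)
  have "n div k < k ^ ndigits k (n div k)" using ndigits_le_iff by blast
  then show "ndigits k n \<le> Suc (ndigits k (n div k))"
    unfolding ndigits_le_iff using k by (simp add: div_less_iff_less_mult mult.commute)
next
  assume "n > 0"
  moreover have "n < k ^ ndigits k n" using ndigits_le_iff by blast
  ultimately obtain l where l: "ndigits k n = Suc l" by (cases "ndigits k n") auto
  then have "n < k ^ Suc l" using ndigits_le_iff[of n "Suc l"] by simp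
  then have "n div k < k ^ l" using k by (simp add: div_less_iff_less_mult mult.commute)
  then show "Suc (ndigits k (n div k)) \<le> ndigits k n" by (simp add: l ndigits_le_iff)
qed

lemma accepted_front: "n > 0 \<Longrightarrow> n \<in> acc q \<longleftrightarrow> n div k \<in> acc (d q (n mod k))"
  by (simp add: accepted_def ndigits_pos steps_front)

text \<open>For \<open>v > 0\<close> the padded block \<open>w\<close> followed by the expansion of
  \<open>v\<close> is again canonical. For \<open>v = 0\<close> the padding could consist of leading
  zeros, which are never read.\<close>

lemma accepted_append:
  "w < k ^ l \<Longrightarrow> v > 0 \<Longrightarrow> w + k ^ l * v \<in> acc q \<longleftrightarrow> v \<in> acc (st q w l)"
proof (induction l arbitrary: q w)
  case (Suc l)
  have e: "w + k ^ Suc l * v = w + k * (k ^ l * v)" by simp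
  have "(w + k ^ Suc l * v) mod k = w mod k" by (simp only: e mod_mult_self2)
  moreover have "(w + k ^ Suc l * v) div k = w div k + k ^ l * v"
    unfolding e using k by (subst div_mult_self2) auto
  moreover have "w div k < k ^ l"
    using Suc.prems k by (simp add: div_less_iff_less_mult mult.commute)
  moreover have "w + k ^ Suc l * v > 0" using Suc.prems k by simp
  ultimately show ?case using Suc.IH Suc.prems by (simp only: steps_front accepted_front)
qed simp

definition reachable :: "nat \<Rightarrow> nat \<Rightarrow> bool" where
  "reachable q q' \<longleftrightarrow> (\<exists>l w. w < k ^ l \<and> st q w l = q')"

text \<open>Translates words into paths of a finite relation, where path lengths can be bounded by
  the number of edges.\<close>

lemma relpow_edges_iff:
  "(q, q') \<in> {(p, d p a) | p a. p < s \<and> a < k} ^^ l \<longleftrightarrow> (\<exists>w<k ^ l. st q w l = q')" (is "_ \<in> ?E ^^ l \<longleftrightarrow> _")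
  if "q < s"
  using that
proof (induction l arbitrary: q)
  case (Suc l)
  have "(q, q') \<in> ?E ^^ Suc l \<longleftrightarrow> (\<exists>a<k. (d q a, q') \<in> ?E ^^ l)"
    unfolding relpow.simps relpow_commute[symmetric] using Suc.prems by auto
  also have "\<dots> \<longleftrightarrow> (\<exists>a<k. \<exists>w<k ^ l. st (d q a) w l = q')"
    using Suc.IH step_less Suc.prems by auto
  also have "\<dots> \<longleftrightarrow> (\<exists>w<k ^ Suc l. st q w (Suc l) = q')" (is "?L \<longleftrightarrow> ?R")
  proof
    assume ?L
    then obtain a w where aw: "a < k" "w < k ^ l" "st (d q a) w l = q'" by blast
    have "a + k * w < k * Suc w" using aw by simp
    also have "\<dots> \<le> k * k ^ l" using aw by (intro mult_le_mono) auto
    finally have "a + k * w < k ^ Suc l" by simp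
    moreover have "st q (a + k * w) (Suc l) = q'"
      using aw k by (simp add: steps_front div_add1_eq)
    ultimately show ?R by blast
  next
    assume ?R
    then obtain w where w: "w < k ^ Suc l" "st q w (Suc l) = q'" by blast
    have "w div k < k ^ l" "w mod k < k"
      using w k by (simp_all add: div_less_iff_less_mult mult.commute)
    then show ?L using w by (metis steps_front)
  qed
  finally show ?case .
qed simp

text \<open>A path can be shortened to at most as many steps as there are edges, and there are at
  most \<open>s * s\<close> edges. This makes reachability a bounded search.\<close>

lemma reachable_bounded:
  assumes "q < s"
  shows "reachable q q' \<longleftrightarrow> (\<exists>l<Suc (s * s). \<exists>w<k ^ l. st q w l = q')"
proof
  let ?E = "{(p, d p a) | p a. p < s \<and> a < k}"
  have sub: "?E \<subseteq> {..<s} \<times> {..<s}" using step_less by auto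
  have fin: "finite ?E" by (rule finite_subset[OF sub]) simp
  have "card ?E \<le> s * s" using card_mono[OF _ sub] by simp
  assume "reachable q q'"
  then obtain l w where "w < k ^ l" "st q w l = q'" unfolding reachable_def by blast
  then have "(q, q') \<in> ?E\<^sup>*" using relpow_edges_iff[OF assms] relpow_imp_rtrancl by blast
  then obtain l' where "l' \<le> card ?E" "(q, q') \<in> ?E ^^ l'"
    unfolding rtrancl_finite_eq_relpow[OF fin] by auto
  then show "\<exists>l<Suc (s * s). \<exists>w<k ^ l. st q w l = q'"
    using relpow_edges_iff[OF assms] \<open>card ?E \<le> s * s\<close> by (auto simp: less_Suc_eq_le intro: order_trans)
qed (auto simp: reachable_def)

text \<open>Positivity of \<open>v\<close> is what permits prefixing further digits by
  \<open>accepted_append\<close>.\<close>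

definition live :: "nat \<Rightarrow> bool" where
  "live q \<longleftrightarrow> (\<exists>v>0. v \<in> acc q)"

text \<open>Splitting off the leading digit \<open>a\<close>, which is nonzero, leaves only
  reachability, for which a bound is known.\<close>

lemma live_iff:
  assumes "q < s"
  shows "live q \<longleftrightarrow> (\<exists>q'<s. reachable q q' \<and> (\<exists>a<k. 0 < a \<and> F (d q' a)))"
proof
  assume "live q"
  then obtain v where v: "v > 0" "v \<in> acc q" unfolding live_def by blast
  define l where "l = ndigits k (v div k)"
  have l: "ndigits k v = Suc l" using v ndigits_pos l_def by simp
  have a: "0 < v div k ^ l"
    using ndigits_le_iff[of v l] l k by (simp add: div_greater_zero_iff)
  have "v < k ^ Suc l" using ndigits_le_iff[of v "Suc l"] l by simp
  then have a': "v div k ^ l < k" using k by (simp add: div_less_iff_less_mult)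
  have "v = v mod k ^ l + k ^ l * (v div k ^ l)" by simp
  then have "st q v l = st q (v mod k ^ l) l"
    using steps_append[of "v mod k ^ l" l q "v div k ^ l" 0] k by simp
  then have "reachable q (st q v l)" unfolding reachable_def using k
    by (intro exI[of _ l] exI[of _ "v mod k ^ l"]) auto
  moreover have "F (d (st q v l) (v div k ^ l))"
    using v l a' by (simp add: accepted_def steps_Suc)
  ultimately show "\<exists>q'<s. reachable q q' \<and> (\<exists>a<k. 0 < a \<and> F (d q' a))"
    using a a' steps_less[OF assms] by blast
next
  assume "\<exists>q'<s. reachable q q' \<and> (\<exists>a<k. 0 < a \<and> F (d q' a))"
  then obtain w l a where w: "w < k ^ l" "a < k" "0 < a" "F (d (st q w l) a)"
    unfolding reachable_def by blast
  have "a \<in> acc (st q w l)"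
    using w accepted_front[of a] by (simp add: accepted_def)
  then show "live q" using accepted_append[of w l a q] w unfolding live_def
    by (intro exI[of _ "w + k ^ l * a"]) auto
qed

text \<open>This condition separates exponential from polynomial growth of the set of accepted words.\<close>

definition branching :: "nat \<Rightarrow> bool" where
  "branching q0 \<longleftrightarrow> (\<exists>q<s. reachable q0 q \<and> live q \<and>
     (\<exists>a<k. \<exists>b<k. a \<noteq> b \<and> reachable (d q a) q \<and> reachable (d q b) q))"

end

section \<open>Sums of at most \<open>j\<close> elements\<close>

lemma sum_of_at_most_0 [simp]: "sum_of_at_most 0 S n \<longleftrightarrow> n = 0"
  by (auto simp: sum_of_at_most_def)

text \<open>Admitting the summand \<open>0\<close> turns "at most" into "exactly", so that raising
  the order by one is the formation of a sumset.\<close>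

lemma sum_of_at_most_Suc:
  "sum_of_at_most (Suc j) S n \<longleftrightarrow> (\<exists>x y. x \<in> insert 0 S \<and> sum_of_at_most j S y \<and> n = x + y)"
proof
  assume "sum_of_at_most (Suc j) S n"
  then obtain xs where xs: "length xs \<le> Suc j" "set xs \<subseteq> S" "sum_list xs = n"
    unfolding sum_of_at_most_def by blast
  show "\<exists>x y. x \<in> insert 0 S \<and> sum_of_at_most j S y \<and> n = x + y"
  proof (cases xs)
    case Nil
    then show ?thesis using xs by (intro exI[of _ 0]) (auto simp: sum_of_at_most_def intro!: exI[of _ "[]"])
  next
    case (Cons x ys)
    then show ?thesis using xs
      by (intro exI[of _ x] exI[of _ "sum_list ys"]) (auto simp: sum_of_at_most_def)
  qed
next
  assume "\<exists>x y. x \<in> insert 0 S \<and> sum_of_at_most j S y \<and> n = x + y"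
  then obtain x xs where xs: "x \<in> insert 0 S" "length xs \<le> j" "set xs \<subseteq> S" "n = x + sum_list xs"
    unfolding sum_of_at_most_def by blast
  then show "sum_of_at_most (Suc j) S n"
    unfolding sum_of_at_most_def
    by (intro exI[of _ "if x \<in> S then x # xs else xs"]) auto
qed

lemma sum_of_at_most_mono: "sum_of_at_most i S n \<Longrightarrow> i \<le> j \<Longrightarrow> sum_of_at_most j S n"
  unfolding sum_of_at_most_def using order_trans by blast

lemma sum_of_at_most_add:
  "sum_of_at_most i S m \<Longrightarrow> sum_of_at_most j S n \<Longrightarrow> sum_of_at_most (i + j) S (m + n)"
  unfolding sum_of_at_most_def by (metis add_mono length_append set_append sum_list_append Un_least)

lemma sum_of_at_most_mult: "sum_of_at_most i S m \<Longrightarrow> sum_of_at_most (t * i) S (t * m)"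
  by (induction t) (auto intro: sum_of_at_most_add)

lemma sum_of_at_most_1: "n \<in> S \<Longrightarrow> sum_of_at_most 1 S n"
  unfolding sum_of_at_most_def by (intro exI[of _ "[n]"]) auto

lemma dvd_sum_of_at_most: "\<forall>n\<in>S. (c::nat) dvd n \<Longrightarrow> sum_of_at_most j S n \<Longrightarrow> c dvd n"
proof -
  have "\<forall>x\<in>set xs. c dvd x \<Longrightarrow> c dvd sum_list xs" for xs by (induction xs) auto
  then show "\<forall>n\<in>S. c dvd n \<Longrightarrow> sum_of_at_most j S n \<Longrightarrow> c dvd n"
    unfolding sum_of_at_most_def by blast
qed

lemma sum_of_at_most_iff_sum:
  "sum_of_at_most j S n \<longleftrightarrow> (\<exists>f. (\<forall>i<j. f i \<in> insert 0 S) \<and> (\<Sum>i<j. f i) = n)"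
proof (induction j arbitrary: n)
  case (Suc j)
  show ?case
  proof
    assume "sum_of_at_most (Suc j) S n"
    then obtain x f where "x \<in> insert 0 S" "\<forall>i<j. f i \<in> insert 0 S" "n = x + (\<Sum>i<j. f i)"
      unfolding sum_of_at_most_Suc Suc.IH by blast
    then show "\<exists>f. (\<forall>i<Suc j. f i \<in> insert 0 S) \<and> (\<Sum>i<Suc j. f i) = n"
      by (intro exI[of _ "f(j := x)"]) (auto simp: less_Suc_eq)
  next
    assume "\<exists>f. (\<forall>i<Suc j. f i \<in> insert 0 S) \<and> (\<Sum>i<Suc j. f i) = n"
    then obtain f where f: "\<forall>i<Suc j. f i \<in> insert 0 S" "(\<Sum>i<Suc j. f i) = n" by blast
    have "f j \<in> insert 0 S" "n = f j + (\<Sum>i<j. f i)" using f by auto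
    moreover have "sum_of_at_most j S (\<Sum>i<j. f i)" 
      unfolding Suc.IH using f by (intro exI[of _ f]) auto
    ultimately show "sum_of_at_most (Suc j) S n"
      unfolding sum_of_at_most_Suc by blast
  qed
qed simp

lemma ex_digits:
  fixes f :: "nat \<Rightarrow> nat"
  assumes "\<forall>i<j. f i < b"
  shows "\<exists>c<b ^ j. \<forall>i<j. c div b ^ i mod b = f i"
  using assms
proof (induction j arbitrary: f)
  case (Suc j)
  then have "\<forall>i<j. f (Suc i) < b" by simp
  from Suc.IH[OF this] obtain c where c: "c < b ^ j" "\<forall>i<j. c div b ^ i mod b = f (Suc i)" by blast
  have "f 0 < b" using Suc.prems by simp
  then have "f 0 + b * c < b * Suc c" by simp
  also have "\<dots> \<le> b * b ^ j" using c by (intro mult_le_mono) auto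
  finally have "f 0 + b * c < b ^ Suc j" by simp
  moreover have "(f 0 + b * c) div b ^ i mod b = f i" if "i < Suc j" for i
  proof (cases i)
    case (Suc i')
    have "(f 0 + b * c) div b ^ i = c div b ^ i'"
      using \<open>f 0 < b\<close> by (simp add: Suc div_mult2_eq)
    then show ?thesis using c that Suc by simp
  qed (use \<open>f 0 < b\<close> in simp)
  ultimately show ?case by blast
qed simp

text \<open>The summands are at most \<open>n\<close>, hence are digits in base
  \<open>Suc n\<close>. One number \<open>c\<close> below an explicit bound encodes the whole tuple,
  which makes the quantifier bounded.\<close>

lemma sum_of_at_most_iff_digits:
  "sum_of_at_most j S n \<longleftrightarrow>
    (\<exists>c<Suc n ^ j. (\<forall>i<j. c div Suc n ^ i mod Suc n \<in> insert 0 S) \<and>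
       (\<Sum>i<j. c div Suc n ^ i mod Suc n) = n)"
proof
  assume "sum_of_at_most j S n"
  then obtain f where f: "\<forall>i<j. f i \<in> insert 0 S" "(\<Sum>i<j. f i) = n"
    unfolding sum_of_at_most_iff_sum by blast
  then have "\<forall>i<j. f i < Suc n" by (metis finite_lessThan lessThan_iff less_Suc_eq_le member_le_sum zero_le)
  from ex_digits[OF this] f show "\<exists>c<Suc n ^ j. (\<forall>i<j. c div Suc n ^ i mod Suc n \<in> insert 0 S) \<and>
       (\<Sum>i<j. c div Suc n ^ i mod Suc n) = n"
    by (metis (no_types, lifting) lessThan_iff sum.cong)
next
  assume "\<exists>c<Suc n ^ j. (\<forall>i<j. c div Suc n ^ i mod Suc n \<in> insert 0 S) \<and>
       (\<Sum>i<j. c div Suc n ^ i mod Suc n) = n"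
  then obtain c where "\<forall>i<j. c div Suc n ^ i mod Suc n \<in> insert 0 S"
    "(\<Sum>i<j. c div Suc n ^ i mod Suc n) = n" by blast
  then show "sum_of_at_most j S n"
    unfolding sum_of_at_most_iff_sum by (intro exI[of _ "\<lambda>i. c div Suc n ^ i mod Suc n"]) simp
qed


section \<open>Kernels and pumping\<close>

text \<open>A finite closed family containing \<open>A\<close> contains the \<open>k\<close>-kernel
  of \<open>A\<close>. Its members act as the states reached after reading low digits.\<close>

definition kernel_closed :: "nat \<Rightarrow> nat set set \<Rightarrow> bool" where
  "kernel_closed k \<A> \<longleftrightarrow> (\<forall>A\<in>\<A>. \<forall>a<k. {n. k * n + a \<in> A} \<in> \<A>)"

lemma kernel_closed_iterate:
  assumes "kernel_closed k \<A>" "A \<in> \<A>" "k > 0"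
  shows "{n. k ^ i * n + r mod k ^ i \<in> A} \<in> \<A>"
proof (induction i)
  case (Suc i)
  have "r mod k ^ Suc i = k ^ i * (r div k ^ i mod k) + r mod k ^ i"
    unfolding power_Suc2 by (rule mod_mult2_eq)
  then have "{n. k ^ Suc i * n + r mod k ^ Suc i \<in> A} =
      {n. k * n + r div k ^ i mod k \<in> {n. k ^ i * n + r mod k ^ i \<in> A}}"
    by (simp add: algebra_simps)
  moreover have "r div k ^ i mod k < k" using assms by simp
  ultimately show ?case using Suc assms unfolding kernel_closed_def by metis
qed (use assms in simp)

text \<open>Among the \<open>Q + 1\<close> residual sets along the low digits of \<open>n\<close>,
  two agree. The two low blocks are then interchangeable below any higher part \<open>m\<close>,
  which is the pumping lemma at the least significant end.\<close>

lemma kernel_pigeonhole: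
  assumes "kernel_closed k \<A>" "A \<in> \<A>" "k > 0" "finite \<A>" "card \<A> \<le> Q"
  obtains i i' where "i < i'" "i' \<le> Q"
    "\<And>m. k ^ i * m + n mod k ^ i \<in> A \<longleftrightarrow> k ^ i' * m + n mod k ^ i' \<in> A"
proof -
  let ?f = "\<lambda>i. {m. k ^ i * m + n mod k ^ i \<in> A}"
  have "?f ` {..Q} \<subseteq> \<A>" using kernel_closed_iterate[OF assms(1-3)] by auto
  then have "\<not> inj_on ?f {..Q}"
    using card_inj_on_le[of ?f "{..Q}" \<A>] assms by auto
  then obtain i i' where "i \<noteq> i'" "i \<le> Q" "i' \<le> Q" "?f i = ?f i'"
    unfolding inj_on_def by auto
  then show ?thesis using that[of i i'] that[of i' i] by (cases "i < i'") (auto simp: set_eq_iff)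
qed

lemma pump_bounds:
  fixes k :: nat
  assumes "k \<ge> 2" "i < i'" "m > 0"
  shows "k ^ i * Suc m \<le> k ^ i' * m"
proof -
  have "k ^ i * Suc m \<le> k ^ i * (2 * m)" using assms by (intro mult_le_mono) auto
  also have "\<dots> \<le> k ^ i * (k * m)" using assms by (intro mult_le_mono) auto
  also have "\<dots> = k ^ Suc i * m" by simp
  also have "\<dots> \<le> k ^ i' * m" using assms by (intro mult_le_mono power_increasing) auto
  finally show ?thesis .
qed

context
  fixes k Q :: nat and \<A> :: "nat set set" and A :: "nat set"
  assumes k: "k \<ge> 2" and cl: "kernel_closed k \<A>" and A: "A \<in> \<A>"
    and fin: "finite \<A>" and Q: "card \<A> \<le> Q"
begin

text \<open>Cuts the digits from \<open>i\<close> to \<open>i' - 1\<close> out of \<open>n\<close>.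
  The lower bound on \<open>n'\<close> keeps a descent from jumping over the interval that is
  tested.\<close>

lemma pump_down:
  assumes "n \<ge> k ^ Q" "n \<notin> A"
  shows "\<exists>n'. n' < n \<and> n div k ^ Q \<le> n' \<and> n' \<notin> A"
proof -
  obtain i i' where i: "i < i'" "i' \<le> Q"
    "\<And>m. k ^ i * m + n mod k ^ i \<in> A \<longleftrightarrow> k ^ i' * m + n mod k ^ i' \<in> A"
    using kernel_pigeonhole[OF cl A _ fin Q, of n] k by auto
  define m where "m = n div k ^ i'"
  have "k ^ i' \<le> k ^ Q" using i k by (intro power_increasing) auto
  then have "k ^ i' \<le> n" "n div k ^ Q \<le> n div k ^ i'"
    using order_trans[OF _ assms(1)] k div_le_mono2[of "k ^ i'" "k ^ Q" n] by simp_all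
  then have m: "m \<ge> n div k ^ Q" "m > 0" unfolding m_def using k
    by (auto simp: div_greater_zero_iff)
  have "k ^ i * m + n mod k ^ i \<notin> A"
    unfolding i(3) unfolding m_def using assms by simp
  moreover have "k ^ i * m + n mod k ^ i < k ^ i * Suc m" using k by simp
  moreover have "\<dots> \<le> k ^ i' * m" using pump_bounds[OF k i(1)] m by simp
  moreover have "\<dots> \<le> n" unfolding m_def by simp
  moreover have "m \<le> k ^ i * m + n mod k ^ i" using k
    by (intro trans_le_add1) simp
  ultimately show ?thesis using m by (intro exI[of _ "k ^ i * m + n mod k ^ i"]) auto
qed

text \<open>Repeats the digits from \<open>i\<close> to \<open>i' - 1\<close> once more.\<close>

lemma pump_up:
  assumes "n \<ge> k ^ Q" "n \<notin> A"
  shows "\<exists>n'>n. n' \<notin> A"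
proof -
  obtain i i' where i: "i < i'" "i' \<le> Q"
    "\<And>m. k ^ i * m + n mod k ^ i \<in> A \<longleftrightarrow> k ^ i' * m + n mod k ^ i' \<in> A"
    using kernel_pigeonhole[OF cl A _ fin Q, of n] k by auto
  define m where "m = n div k ^ i"
  have "k ^ i \<le> k ^ Q" using i k by (intro power_increasing) auto
  then have "k ^ i \<le> n" using assms by simp
  then have m: "m > 0" unfolding m_def using k by (simp add: div_greater_zero_iff)
  have "k ^ i' * m + n mod k ^ i' \<notin> A"
    unfolding i(3)[symmetric] unfolding m_def using assms by simp
  moreover have "n < k ^ i * Suc m"
    unfolding m_def using k dividend_less_times_div[of "k ^ i" n] by simp
  moreover have "\<dots> \<le> k ^ i' * m" using pump_bounds[OF k i(1)] m by simp
  ultimately show ?thesis by (intro exI[of _ "k ^ i' * m + n mod k ^ i'"]) auto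
qed

lemma all_iff_bounded: "(\<forall>n. n \<in> A) \<longleftrightarrow> (\<forall>n<k ^ Q. n \<in> A)"
proof (intro iffI allI)
  fix n assume B: "\<forall>n<k ^ Q. n \<in> A"
  show "n \<in> A"
  proof (induction n rule: less_induct)
    case (less n)
    then show ?case using B pump_down[of n] by (meson not_le)
  qed
qed simp

text \<open>A missing number from \<open>k ^ Q\<close> on can be pumped up forever. Pumping down
  divides by at most about \<open>k ^ Q\<close>, so from a number at least
  \<open>k ^ (2 * Q)\<close> it stays at or above \<open>k ^ Q\<close>, and the descent ends inside
  the tested interval.\<close>

lemma cofinite_iff_bounded:
  "(\<exists>N. \<forall>n\<ge>N. n \<in> A) \<longleftrightarrow> (\<forall>n<k ^ (2 * Q). k ^ Q \<le> n \<longrightarrow> n \<in> A)"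
proof (intro iffI allI impI)
  fix n assume "\<exists>N. \<forall>n\<ge>N. n \<in> A" and n: "k ^ Q \<le> n"
  then obtain N where N: "\<forall>n\<ge>N. n \<in> A" by blast
  have "n \<in> A" if "k ^ Q \<le> n" for n
    using that
  proof (induction "N - n" arbitrary: n rule: less_induct)
    case less
    show ?case
    proof (rule ccontr)
      assume n: "n \<notin> A"
      from pump_up[OF less.prems n] obtain n' where n': "n' > n" "n' \<notin> A" by blast
      moreover have "n < N" using N n not_le by blast
      ultimately have "N - n' < N - n" "k ^ Q \<le> n'" using less.prems by auto
      then show False using less.hyps n' by blast
    qed
  qed
  then show "n \<in> A" using n .
next
  assume B: "\<forall>n<k ^ (2 * Q). k ^ Q \<le> n \<longrightarrow> n \<in> A"
  have "k ^ Q \<le> n \<longrightarrow> n \<in> A" for n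
  proof (induction n rule: less_induct)
    case (less n)
    show ?case
    proof (intro impI, rule ccontr)
      assume n: "k ^ Q \<le> n" "n \<notin> A"
      then have "k ^ Q * k ^ Q \<le> n" using B by (metis mult_2 not_le power_add)
      then have "k ^ Q \<le> n div k ^ Q" using k by (simp add: less_eq_div_iff_mult_less_eq)
      then show False using pump_down[OF n] less by (meson order_trans)
    qed
  qed
  then show "\<exists>N. \<forall>n\<ge>N. n \<in> A" by blast
qed

end

section \<open>Kernels of sumsets: addition with carry\<close>

definition carry_sum :: "nat set \<Rightarrow> nat set \<Rightarrow> nat \<Rightarrow> nat set" where
  "carry_sum A B c = {x + y + c | x y. x \<in> A \<and> y \<in> B}"

text \<open>One column of written addition: \<open>u\<close> and \<open>v\<close> are the lowest
  digits of the summands, \<open>c\<close> is the incoming and \<open>c'\<close> the outgoing carry.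
  A union appears because the sum digit \<open>a\<close> does not determine \<open>u\<close> and
  \<open>v\<close>.\<close>

lemma carry_sum_kernel:
  assumes "k \<ge> 2" "c \<le> 1" "a < k"
  shows "{n. k * n + a \<in> carry_sum A B c} =
    \<Union> {carry_sum {n. k * n + u \<in> A} {n. k * n + v \<in> B} c' | u v c'.
        u < k \<and> v < k \<and> c' \<le> 1 \<and> u + v + c = a + k * c'}" (is "?L = ?R")
proof (intro set_eqI iffI)
  fix n assume "n \<in> ?L"
  then obtain x y where xy: "x \<in> A" "y \<in> B" "k * n + a = x + y + c"
    unfolding carry_sum_def by blast
  define u v where "u = x mod k" and "v = y mod k"
  define c' where "c' = (u + v + c) div k"
  have uv: "u < k" "v < k" using assms unfolding u_def v_def by auto
  then have "u + v + c < k * 2" using assms by simp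
  then have c': "c' \<le> 1" unfolding c'_def using assms
    by (simp add: div_less_iff_less_mult less_Suc_eq_le[symmetric] mult.commute)
  have x: "x = k * (x div k) + u" and y: "y = k * (y div k) + v" unfolding u_def v_def by simp_all
  have eq: "k * n + a = k * (x div k + y div k) + (u + v + c)"
    using xy x y by (simp add: distrib_left)
  have "a = (u + v + c) mod k"
    using arg_cong[OF eq, of "\<lambda>z. z mod k"] assms by simp
  then have a: "u + v + c = a + k * c'" unfolding c'_def by simp
  have "k * n = k * (x div k + y div k + c')" using eq a by (simp add: distrib_left)
  then have n: "n = x div k + y div k + c'" using assms by simp
  have "n \<in> carry_sum {n. k * n + u \<in> A} {n. k * n + v \<in> B} c'"
    unfolding carry_sum_def
    by (intro CollectI exI[of _ "x div k"] exI[of _ "y div k"]) (use n x y xy in auto)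
  then show "n \<in> ?R" using uv c' a by blast
next
  fix n assume "n \<in> ?R"
  then obtain u v c' x y where *: "k * x + u \<in> A" "k * y + v \<in> B" "n = x + y + c'"
    "u + v + c = a + k * c'"
    unfolding carry_sum_def by blast
  have "k * n + a = (k * x + u) + (k * y + v) + c"
    using * by (simp add: distrib_left)
  then show "n \<in> ?L" using * unfolding carry_sum_def by blast
qed

text \<open>The unions force a subset construction: there are at most \<open>2 * p * q\<close> carry
  sums, one factor \<open>2\<close> for the carry, and the unions of them form the closed family.
  Hence the exponential bound.\<close>

lemma kernel_sum:
  assumes k: "k \<ge> 2" and "kernel_closed k \<A>" "kernel_closed k \<B>" "finite \<A>" "finite \<B>"
    and "A \<in> \<A>" "B \<in> \<B>" and "card \<A> \<le> p" "card \<B> \<le> q"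
  shows "\<exists>\<C>. kernel_closed k \<C> \<and> finite \<C> \<and> card \<C> \<le> 2 ^ (2 * p * q) \<and>
    {x + y | x y. x \<in> A \<and> y \<in> B} \<in> \<C>"
proof -
  define \<W> where "\<W> = (\<lambda>(A, B, c). carry_sum A B c) ` (\<A> \<times> \<B> \<times> {..1})"
  have fin: "finite \<W>" unfolding \<W>_def using assms by simp
  have "card \<W> \<le> card (\<A> \<times> \<B> \<times> {..1::nat})"
    unfolding \<W>_def using assms by (intro card_image_le) simp
  also have "\<dots> \<le> 2 * p * q" 
    using mult_le_mono[OF assms(8,9)] by (simp add: card_cartesian_product distrib_left)
  finally have card: "card \<W> \<le> 2 * p * q" .
  have W: "carry_sum A' B' c \<in> \<W>" if "A' \<in> \<A>" "B' \<in> \<B>" "c \<le> 1" for A' B' c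
    unfolding \<W>_def using that by force
  define \<C> where "\<C> = Union ` Pow \<W>"
  have C: "\<Union> \<X> \<in> \<C>" if "\<X> \<subseteq> \<W>" for \<X> using that \<C>_def by auto
  have step: "{n. k * n + a \<in> X} \<in> \<C>" if "X \<in> \<W>" "a < k" for X a
  proof -
    obtain A' B' c where *: "A' \<in> \<A>" "B' \<in> \<B>" "c \<le> 1" "X = carry_sum A' B' c"
      using \<open>X \<in> \<W>\<close> unfolding \<W>_def by auto
    show ?thesis unfolding *(4) carry_sum_kernel[OF k *(3) that(2)]
      by (rule C) (use * assms in \<open>auto simp: kernel_closed_def intro!: W\<close>)
  qed
  have "kernel_closed k \<C>"
    unfolding kernel_closed_def
  proof (intro ballI allI impI)
    fix Y a assume "Y \<in> \<C>" and a: "a < k"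
    then obtain \<X> where X: "\<X> \<subseteq> \<W>" "Y = \<Union> \<X>" unfolding \<C>_def by auto
    have "\<forall>X\<in>\<X>. \<exists>\<Y>. \<Y> \<subseteq> \<W> \<and> {n. k * n + a \<in> X} = \<Union> \<Y>"
    proof
      fix X assume "X \<in> \<X>"
      then have "{n. k * n + a \<in> X} \<in> Union ` Pow \<W>" using step[OF _ a] X unfolding \<C>_def by blast
      then show "\<exists>\<Y>. \<Y> \<subseteq> \<W> \<and> {n. k * n + a \<in> X} = \<Union> \<Y>" by (elim imageE) auto
    qed
    then obtain g where g: "\<forall>X\<in>\<X>. g X \<subseteq> \<W> \<and> {n. k * n + a \<in> X} = \<Union> (g X)"
      unfolding bchoice_iff by blast
    have "{n. k * n + a \<in> Y} = (\<Union>X\<in>\<X>. {n. k * n + a \<in> X})" using X by auto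
    also have "\<dots> = \<Union> (\<Union> (g ` \<X>))" using g by auto
    also have "\<dots> \<in> \<C>" by (rule C) (use g in auto)
    finally show "{n. k * n + a \<in> Y} \<in> \<C>" .
  qed
  moreover have "finite \<C>" unfolding \<C>_def using fin by simp
  moreover have "card \<C> \<le> 2 ^ (2 * p * q)"
  proof -
    have "card \<C> \<le> card (Pow \<W>)" unfolding \<C>_def using fin by (intro card_image_le) simp
    also have "\<dots> \<le> 2 ^ (2 * p * q)" using card fin by (simp add: card_Pow power_increasing)
    finally show ?thesis .
  qed
  moreover have "{x + y | x y. x \<in> A \<and> y \<in> B} \<in> \<C>"
    using C[of "{carry_sum A B 0}"] W[of A B 0] assms by (simp add: carry_sum_def)
  ultimately show ?thesis by blast
qed

text \<open>Iterates the bound of \<open>kernel_sum\<close>. The initial \<open>2\<close> is the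
  size of the family \<open>{{0}, {}}\<close> for the empty sum, and \<open>2 * s\<close> counts the
  pairs of a state and a bit in \<open>padded_family\<close>.\<close>

primrec sum_states :: "nat \<Rightarrow> nat \<Rightarrow> nat" where
  "sum_states s 0 = 2"
| "sum_states s (Suc j) = 2 ^ (2 * (2 * s) * sum_states s j)"

context digit_automaton
begin

text \<open>The bit decides membership of \<open>0\<close>, whose expansion is empty rather than a block of zeros.\<close>

definition padded :: "nat \<Rightarrow> bool \<Rightarrow> nat set" where
  "padded q b = {n. if n = 0 then b else n \<in> acc q}"

lemma padded_kernel:
  "a < k \<Longrightarrow> {n. k * n + a \<in> padded q b} = padded (d q a) (if a = 0 then b else a \<in> acc q)"
  using k accepted_front[of _ q] by (auto simp: padded_def)

definition padded_family :: "nat set set" where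
  "padded_family = (\<lambda>(q, b). padded q b) ` ({..<s} \<times> UNIV)"

lemma padded_family:
  "kernel_closed k padded_family" "finite padded_family" "card padded_family \<le> 2 * s"
proof -
  show "kernel_closed k padded_family"
    using padded_kernel step_less unfolding kernel_closed_def padded_family_def by force
  show "finite padded_family" unfolding padded_family_def by simp
  show "card padded_family \<le> 2 * s"
    unfolding padded_family_def
    by (rule order_trans[OF card_image_le]) (auto simp: card_cartesian_product)
qed

lemma sum_of_at_most_kernel:
  assumes "q < s"
  shows "\<exists>\<A>. kernel_closed k \<A> \<and> finite \<A> \<and> card \<A> \<le> sum_states s j \<and>
    {n. sum_of_at_most j (acc q) n} \<in> \<A>"
proof (induction j)
  case 0
  have "{n. k * n + a \<in> {0}} \<in> {{0}, {}}" if "a < k" for a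
    using k by (cases "a = 0") auto
  then have "kernel_closed k {{0}, {}}" unfolding kernel_closed_def by auto
  then show ?case by (intro exI[of _ "{{0}, {}}"]) simp
next
  case (Suc j)
  then obtain \<A> where a: "kernel_closed k \<A>" "finite \<A>" "card \<A> \<le> sum_states s j"
    "{n. sum_of_at_most j (acc q) n} \<in> \<A>" by blast
  \<comment> \<open>The bit \<open>True\<close> supplies the optional summand \<open>0\<close> of
    \<open>sum_of_at_most_Suc\<close>.\<close>
  have p: "padded q True \<in> padded_family" using assms unfolding padded_family_def by force
  obtain \<C> where C: "kernel_closed k \<C>" "finite \<C>" "card \<C> \<le> sum_states s (Suc j)"
    "{x + y | x y. x \<in> padded q True \<and> y \<in> {n. sum_of_at_most j (acc q) n}} \<in> \<C>"
    using kernel_sum[OF k padded_family(1) a(1) padded_family(2) a(2) p a(4) padded_family(3) a(3)]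
    by auto
  have "padded q True = insert 0 (acc q)" by (auto simp: padded_def)
  then have "{n. sum_of_at_most (Suc j) (acc q) n} \<in> \<C>"
    using C(4) by (simp add: sum_of_at_most_Suc conj_ac)
  then show ?case using C by blast
qed

lemma asymptotic_order_iff:
  assumes "q < s"
  shows "asymptotic_additive_basis_of_order j (acc q) \<longleftrightarrow>
    (\<forall>n<k ^ (2 * sum_states s j). k ^ sum_states s j \<le> n \<longrightarrow> sum_of_at_most j (acc q) n)"
proof -
  obtain \<A> where "kernel_closed k \<A>" "{n. sum_of_at_most j (acc q) n} \<in> \<A>" "finite \<A>"
    "card \<A> \<le> sum_states s j"
    using sum_of_at_most_kernel[OF assms] by blast
  from cofinite_iff_bounded[OF k this] show ?thesis
    by (simp add: asymptotic_additive_basis_of_order_def)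
qed

lemma order_iff:
  assumes "q < s"
  shows "additive_basis_of_order j (acc q) \<longleftrightarrow>
    (\<forall>n<k ^ sum_states s j. sum_of_at_most j (acc q) n)"
proof -
  obtain \<A> where "kernel_closed k \<A>" "{n. sum_of_at_most j (acc q) n} \<in> \<A>" "finite \<A>"
    "card \<A> \<le> sum_states s j"
    using sum_of_at_most_kernel[OF assms] by blast
  from all_iff_bounded[OF k this] show ?thesis
    by (simp add: additive_basis_of_order_def)
qed

text \<open>Reading a digit turns \<open>c dvd u * n + v\<close> into a condition of the same form,
  whose coefficients can be reduced modulo \<open>c\<close>. Paired with the padded sets this gives
  at most \<open>2 * s * c * c\<close> sets closed under the kernel operations, so a counterexample
  can be pumped down. This makes each candidate divisor testable.\<close>

lemma all_dvd_iff:
  assumes "q < s" "c \<ge> 2"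
  shows "(\<forall>n\<in>acc q. c dvd n) \<longleftrightarrow> (\<forall>n<k ^ (2 * s * c * c). n \<in> acc q \<longrightarrow> c dvd n)"
proof -
  define D where "D = (\<lambda>(q, b, u, v). {n. n \<in> padded q b \<longrightarrow> c dvd u * n + v})"
  let ?I = "{..<s} \<times> (UNIV :: bool set) \<times> {..<c} \<times> {..<c}"
  let ?A = "D ` ?I"
  have "kernel_closed k ?A"
    unfolding kernel_closed_def
  proof (intro ballI allI impI)
    fix X a assume X: "X \<in> ?A" and a: "a < k"
    then obtain q b u v where qb: "X = D (q, b, u, v)" "q < s" "u < c" "v < c" by auto
    have "c dvd u * (k * n + a) + v \<longleftrightarrow> c dvd (u * k mod c) * n + (u * a + v) mod c" for n
    proof -
      have "u * (k * n + a) + v = (u * k) * n + (u * a + v)" by (simp add: algebra_simps)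
      also have "\<dots> = (c * (u * k div c) + u * k mod c) * n + (c * ((u * a + v) div c) + (u * a + v) mod c)"
        by (simp only: mult_div_mod_eq)
      also have "\<dots> = (u * k mod c) * n + (u * a + v) mod c + c * ((u * k div c) * n + (u * a + v) div c)"
        by (simp only: algebra_simps)
      finally show ?thesis by (metis dvd_add_left_iff dvd_triv_left)
    qed
    moreover have "k * n + a \<in> padded q b \<longleftrightarrow> n \<in> padded (d q a) (if a = 0 then b else a \<in> acc q)" for n
      using padded_kernel[OF a, of q b] by blast
    ultimately have "{n. k * n + a \<in> X} =
        D (d q a, if a = 0 then b else a \<in> acc q, u * k mod c, (u * a + v) mod c)"
      unfolding qb(1) D_def by simp
    then show "{n. k * n + a \<in> X} \<in> ?A"
      using qb a step_less by auto
  qed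
  \<comment> \<open>The coefficients \<open>1\<close> and \<open>0\<close> express
    \<open>c dvd n\<close> itself; the bit is harmless because \<open>c dvd 0\<close>.\<close>
  moreover have "D (q, True, 1, 0) \<in> ?A" using assms by auto
  moreover have "finite ?A" by simp
  moreover have "card ?A \<le> 2 * s * c * c"
    by (rule order_trans[OF card_image_le]) (auto simp: card_cartesian_product)
  ultimately have "(\<forall>n. n \<in> D (q, True, 1, 0)) \<longleftrightarrow> (\<forall>n<k ^ (2 * s * c * c). n \<in> D (q, True, 1, 0))"
    by (rule all_iff_bounded[OF k])
  moreover have "n \<in> D (q, True, 1, 0) \<longleftrightarrow> (n \<in> acc q \<longrightarrow> c dvd n)" for n
    by (auto simp: D_def padded_def)
  ultimately show ?thesis by auto
qed

end

section \<open>A branching automaton and coprime elements give an asymptotic basis\<close>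

text \<open>The residues modulo \<open>D\<close> that are reached are closed under addition and so
  form a subgroup; its least positive representative \<open>g\<close> divides all of
  \<open>S\<close> and must be \<open>1\<close>. As there are finitely many residues, the number and
  the size of the summands can be chosen uniformly.\<close>

lemma sums_hit_all_residues:
  fixes S :: "nat set"
  assumes cop: "\<not> (\<exists>c\<ge>2. \<forall>n\<in>S. c dvd n)" and D: "D > 0"
  shows "\<exists>J R. \<forall>n. \<exists>r\<le>R. sum_of_at_most J S r \<and> r mod D = n mod D"
proof -
  define H where "H = {h. \<exists>j x. sum_of_at_most j S x \<and> x mod D = h mod D}"
  have comb: "h1 + t * h2 \<in> H" if h: "h1 \<in> H" "h2 \<in> H" for h1 h2 t
  proof -
    obtain j1 x1 j2 x2 where x: "sum_of_at_most j1 S x1" "x1 mod D = h1 mod D"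
      "sum_of_at_most j2 S x2" "x2 mod D = h2 mod D"
      using h unfolding H_def by blast
    have "sum_of_at_most (j1 + t * j2) S (x1 + t * x2)"
      using x by (intro sum_of_at_most_add sum_of_at_most_mult)
    moreover have "(x1 + t * x2) mod D = (h1 + t * h2) mod D"
      by (rule mod_add_cong[OF x(2) mod_mult_cong[OF refl x(4)]])
    ultimately show ?thesis unfolding H_def by blast
  qed
  have "sum_of_at_most 0 S 0" by simp
  then have H0: "0 \<in> H" and HD: "D \<in> H" unfolding H_def by fastforce+
  define g where "g = (LEAST h. h \<in> H \<and> h > 0)"
  have g: "g \<in> H" "g > 0" using LeastI[of "\<lambda>h. h \<in> H \<and> h > 0" D] HD D unfolding g_def by auto
  have "g dvd n" if "n \<in> S" for n
  proof -
    have "n \<in> H" unfolding H_def using sum_of_at_most_1[OF that] by blast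
    \<comment> \<open>Adding \<open>D - 1\<close> copies is subtraction modulo \<open>D\<close>; the
      result is congruent to \<open>n mod g\<close>.\<close>
    then have *: "n + ((D - 1) * (n div g)) * g \<in> H" using g comb by blast
    have "n + ((D - 1) * (n div g)) * g = n mod g + (n div g) * g + (D - 1) * ((n div g) * g)"
      by simp
    also have "\<dots> = n mod g + D * ((n div g) * g)" using D by (cases D) auto
    finally have "n mod g \<in> H" using * unfolding H_def by simp
    then have "\<not> n mod g > 0"
      using not_less_Least[of "n mod g" "\<lambda>h. h \<in> H \<and> h > 0"] g unfolding g_def[symmetric] by auto
    then show ?thesis by (simp add: dvd_eq_mod_eq_0)
  qed
  then have "g = 1" using cop g by (metis One_nat_def Suc_leI le_antisym not_less_eq_eq numeral_2_eq_2)
  then have "n \<in> H" for n using comb[OF H0 g(1), of n] by simp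
  then have "\<forall>n. \<exists>j x. sum_of_at_most j S x \<and> x mod D = n mod D" unfolding H_def by blast
  then obtain j x where jx: "\<And>n. sum_of_at_most (j n) S (x n) \<and> x n mod D = n mod D" by metis
  show ?thesis
  proof (rule exI[of _ "\<Sum>n<D. j n"], rule exI[of _ "\<Sum>n<D. x n"], rule allI)
    fix n
    have "n mod D \<in> {..<D}" using D by simp
    then have "x (n mod D) \<le> (\<Sum>n<D. x n)" "j (n mod D) \<le> (\<Sum>n<D. j n)"
      by (intro member_le_sum; simp)+
    then show "\<exists>r\<le>\<Sum>n<D. x n. sum_of_at_most (\<Sum>n<D. j n) S r \<and> r mod D = n mod D"
      using jx[of "n mod D"] sum_of_at_most_mono
      by (intro exI[of _ "x (n mod D)"]) auto
  qed
qed

text \<open>Adding progressions with a common difference adds their lengths: \<open>m\<close> is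
  split greedily, with as much as possible in each summand.\<close>

lemma sum_of_at_most_multiple_progression:
  assumes "\<And>m. m < M \<Longrightarrow> sum_of_at_most J S (E + D * m)" "M > 0" "m \<le> t * (M - 1)"
  shows "sum_of_at_most (t * J) S (t * E + D * m)"
  using assms(3)
proof (induction t arbitrary: m)
  case (Suc t)
  define m' where "m' = min m (M - 1)"
  have "m - m' \<le> t * (M - 1)" "m' < M" "m = m' + (m - m')"
    using Suc.prems assms(2) unfolding m'_def by auto
  then have "sum_of_at_most (J + t * J) S ((E + D * m') + (t * E + D * (m - m')))"
    using assms(1) Suc.IH by (intro sum_of_at_most_add) auto
  also have "(E + D * m') + (t * E + D * (m - m')) = Suc t * E + D * m"
    using \<open>m = m' + (m - m')\<close> by (metis add.assoc add.left_commute distrib_left mult_Suc)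
  finally show ?case by simp
qed simp

text \<open>At scale \<open>B ^ n\<close>, sums of \<open>t\<close> blocks cover a progression starting at \<open>t * E n\<close> of length
  proportional to \<open>t * B ^ n\<close>. For large \<open>t\<close> consecutive ones overlap, and boundedly many values
  of \<open>t\<close> suffice to reach the scale \<open>B ^ Suc n\<close>.\<close>

lemma asymptotic_basis_if_progressions:
  fixes S :: "nat set"
  assumes cop: "\<not> (\<exists>c\<ge>2. \<forall>n\<in>S. c dvd n)" and D: "D > 0" and B: "B \<ge> 2"
    and E: "\<And>n. E n \<le> K * B ^ n"
    and prog: "\<And>n m. m < B ^ n \<Longrightarrow> sum_of_at_most J0 S (E n + D * m)"
  shows "asymptotic_additive_basis S"
proof -
  obtain J R where res: "\<And>n. \<exists>r\<le>R. sum_of_at_most J S r \<and> r mod D = n mod D"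
    using sums_hit_all_residues[OF cop D] by blast
  \<comment> \<open>With \<open>t0\<close> blocks the progression is long enough to bridge the gap
    to the next starting point, enlarged by \<open>R\<close>. The number \<open>Q\<close> puts that
    start, plus \<open>R\<close>, below \<open>Q * B ^ n\<close>, and \<open>T\<close> blocks reach
    past \<open>Q * B ^ Suc n\<close>.\<close>
  define t0 where "t0 = 2 * (K + R)"
  define Q where "Q = t0 * K + R + 1"
  define T where "T = 2 * B * Q + t0"
  have "sum_of_at_most (T * J0 + J) S N" if N: "N \<ge> Q * B" for N
  proof -
    let ?P = "\<lambda>n. Q * B ^ n \<le> N"
    have bd: "n \<le> N" if "?P n" for n
    proof -
      have "n < B ^ n" using B by (intro power_gt_expt) simp
      also have "\<dots> \<le> Q * B ^ n" unfolding Q_def by simp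
      finally show ?thesis using that by simp
    qed
    define n where "n = Greatest ?P"
    have P1: "?P 1" using N by simp
    have n: "Q * B ^ n \<le> N" unfolding n_def by (rule GreatestI_nat[of ?P 1 N]) (use P1 bd in auto)
    have n1: "n \<ge> 1" unfolding n_def by (rule Greatest_le_nat[of ?P 1 N]) (use P1 bd in auto)
    have nS: "N < Q * B ^ Suc n"
      using Greatest_le_nat[of ?P "Suc n" N] bd unfolding n_def[symmetric] by (meson Suc_n_not_le_n not_le)
    have "2 \<le> B ^ n" using B n1 power_increasing[of 1 n B] by simp
    then have half: "B ^ n \<le> 2 * (B ^ n - 1)" and pos: "B ^ n \<ge> 1" by auto
    let ?P = "\<lambda>t. t \<le> T \<and> t * E n + R \<le> N"
    have "t0 * E n + R \<le> t0 * (K * B ^ n) + R * B ^ n"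
      using E[of n] pos by (intro add_mono mult_le_mono) auto
    also have "\<dots> \<le> Q * B ^ n" unfolding Q_def by (simp add: algebra_simps)
    finally have P0: "?P t0" using n unfolding T_def by simp
    \<comment> \<open>The largest admissible number of blocks whose progression starts at least
      \<open>R\<close> below \<open>N\<close>; this slack leaves room for the correction
      \<open>r\<close> of the residue.\<close>
    define t where "t = Greatest ?P"
    have t: "t \<le> T" "t * E n + R \<le> N"
      using GreatestI_nat[of ?P t0 T] P0 unfolding t_def by auto
    have t0: "t0 \<le> t" using Greatest_le_nat[of ?P t0 T] P0 unfolding t_def by auto
    have up: "N \<le> t * E n + D * (t * (B ^ n - 1))"
    proof (cases "t = T")
      case True
      have "N \<le> B * Q * B ^ n" using nS by (simp add: algebra_simps)
      also have "\<dots> \<le> B * Q * (2 * (B ^ n - 1))" using half by (intro mult_le_mono) auto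
      also have "\<dots> = 2 * B * Q * (B ^ n - 1)" by simp
      also have "\<dots> \<le> t * (B ^ n - 1)" unfolding True T_def by (intro mult_le_mono) auto
      also have "\<dots> \<le> D * (t * (B ^ n - 1))" using D by simp
      finally show ?thesis by simp
    next
      case False
      then have "\<not> ?P (Suc t)"
        using Greatest_le_nat[of ?P "Suc t" T] unfolding t_def[symmetric] by auto
      then have "N \<le> t * E n + (E n + R)" using False t by simp
      also have "E n + R \<le> K * B ^ n + R * B ^ n" using E[of n] pos by (intro add_mono) auto
      also have "\<dots> = (K + R) * B ^ n" by (simp add: algebra_simps)
      also have "\<dots> \<le> (K + R) * (2 * (B ^ n - 1))" using half by (intro mult_le_mono) auto
      also have "\<dots> = t0 * (B ^ n - 1)" unfolding t0_def by simp
      also have "\<dots> \<le> t * (B ^ n - 1)" using t0 by (intro mult_le_mono) auto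
      also have "\<dots> \<le> D * (t * (B ^ n - 1))" using D by simp
      finally show ?thesis by simp
    qed
    obtain r where r: "r \<le> R" "sum_of_at_most J S r" "r mod D = (N - t * E n) mod D"
      using res by blast
    have "r \<le> N - t * E n" using r t by simp
    then have "D dvd (N - t * E n) - r" using r(3) by (metis mod_eq_dvd_iff_nat)
    then obtain m where m: "(N - t * E n) - r = D * m" by (elim dvdE)
    have "D * m \<le> D * (t * (B ^ n - 1))" using m[symmetric] up by linarith
    then have "m \<le> t * (B ^ n - 1)" using D by simp
    then have "sum_of_at_most (t * J0) S (t * E n + D * m)"
      using prog pos B by (intro sum_of_at_most_multiple_progression[where M = "B ^ n"]) auto
    then have "sum_of_at_most (t * J0 + J) S ((t * E n + D * m) + r)"
      using r by (intro sum_of_at_most_add)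
    moreover have "(t * E n + D * m) + r = N" using m \<open>r \<le> N - t * E n\<close> t by linarith
    ultimately show ?thesis using t sum_of_at_most_mono by (metis add_le_mono1 mult_le_mono1)
  qed
  then show ?thesis
    unfolding asymptotic_additive_basis_def asymptotic_additive_basis_of_order_def by blast
qed

lemma sum_list_map_affine: "sum_list (map (\<lambda>x. w + c * x) xs) = length xs * w + c * sum_list (xs :: nat list)"
  by (induction xs) (auto simp: algebra_simps)

text \<open>Any number below \<open>B ^ n\<close> has digits at most \<open>B - 1\<close>, so it is a sum of \<open>B - 1\<close> numbers with
  digits in \<open>{0, 1}\<close>; here the two available digits are \<open>p\<close> and \<open>p + \<delta>\<close>.\<close>

lemma two_digit_sums:
  fixes B :: nat
  assumes B: "B \<ge> 2" and v: "v \<in> A" and step: "\<And>z. z \<in> A \<Longrightarrow> p + B * z \<in> A \<and> (p + \<delta>) + B * z \<in> A"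
    and m: "m < B ^ n"
  shows "\<exists>xs. length xs = B - 1 \<and> set xs \<subseteq> A \<and>
    sum_list xs + p = B ^ n * ((B - 1) * v + p) + \<delta> * m"
  using m
proof (induction n arbitrary: m)
  case 0
  then show ?case using v by (intro exI[of _ "replicate (B - 1) v"]) (auto simp: sum_list_replicate)
next
  case (Suc n)
  define r where "r = m mod B"
  have r: "r \<le> B - 1" "m = B * (m div B) + r" using B unfolding r_def by (auto simp: less_Suc_eq_le[symmetric])
  have "m div B < B ^ n" using Suc.prems B by (simp add: div_less_iff_less_mult mult.commute)
  from Suc.IH[OF this] obtain xs where xs: "length xs = B - 1" "set xs \<subseteq> A"
    "sum_list xs + p = B ^ n * ((B - 1) * v + p) + \<delta> * (m div B)" by blast
  \<comment> \<open>Exactly \<open>r\<close> of the \<open>B - 1\<close> numbers receive the larger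
    digit, so the new lowest position contributes \<open>r * \<delta>\<close>.\<close>
  define ys where "ys = map (\<lambda>z. (p + \<delta>) + B * z) (take r xs) @ map (\<lambda>z. p + B * z) (drop r xs)"
  have "set ys \<subseteq> A" using step xs(2) set_take_subset[of r xs] set_drop_subset[of r xs]
    unfolding ys_def by auto
  moreover have "length ys = B - 1" unfolding ys_def using xs by simp
  \<comment> \<open>The additional \<open>p\<close> completes the geometric series: the free
    positions contribute \<open>(B - 1) * p * (1 + B + ... + B ^ (n - 1)) = p * (B ^ n - 1)\<close>,
    apart from the multiples of \<open>\<delta>\<close>.\<close>
  moreover have "sum_list ys + p = B ^ Suc n * ((B - 1) * v + p) + \<delta> * m"
  proof -
    have "sum_list ys = r * (p + \<delta>) + (B - 1 - r) * p + B * (sum_list (take r xs) + sum_list (drop r xs))"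
      unfolding ys_def using xs r by (simp only: sum_list_append sum_list_map_affine) (simp add: algebra_simps)
    also have "sum_list (take r xs) + sum_list (drop r xs) = sum_list xs"
      by (metis append_take_drop_id sum_list_append)
    also have "r * (p + \<delta>) + (B - 1 - r) * p = (r + (B - 1 - r)) * p + r * \<delta>"
      by (simp only: distrib_left distrib_right)
    also have "r + (B - 1 - r) = B - 1" using r by simp
    finally have "sum_list ys + p = Suc (B - 1) * p + r * \<delta> + B * sum_list xs" by simp
    also have "Suc (B - 1) = B" using B by simp
    finally have "sum_list ys + p = B * (sum_list xs + p) + r * \<delta>" by (simp add: algebra_simps)
    also have "\<dots> = B ^ Suc n * ((B - 1) * v + p) + \<delta> * (B * (m div B) + r)"
      unfolding xs(3) by (simp add: algebra_simps)
    finally show ?thesis using r by simp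
  qed
  ultimately show ?case by blast
qed

context digit_automaton
begin

text \<open>The two loops may have different lengths. Concatenating them in both orders gives loops
  of the same length, which still differ in their lowest digit; read as numbers, they are the two
  digits \<open>p\<close> and \<open>p + \<delta>\<close> in base \<open>B\<close>.\<close>

lemma asymptotic_basis_if_branching:
  assumes br: "branching q0" and cop: "\<not> (\<exists>c\<ge>2. \<forall>n\<in>acc q0. c dvd n)"
  shows "asymptotic_additive_basis (acc q0)"
proof -
  obtain q a b where q: "reachable q0 q" "live q" and ab: "a < k" "b < k" "a \<noteq> b"
    "reachable (d q a) q" "reachable (d q b) q"
    using br unfolding branching_def by blast
  obtain w l where w: "w < k ^ l" "st q0 w l = q" using q unfolding reachable_def by blast
  obtain v where v: "v > 0" "v \<in> acc q" using q unfolding live_def by blast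
  have loop: "\<exists>X L. L > 0 \<and> X < k ^ L \<and> X mod k = a \<and> st q X L = q"
    if a: "a < k" "reachable (d q a) q" for a
  proof -
    obtain x lx where x: "x < k ^ lx" "st (d q a) x lx = q" using a unfolding reachable_def by blast
    have "a + k * x < k * Suc x" using a by simp
    also have "\<dots> \<le> k * k ^ lx" using x by (intro mult_le_mono) auto
    finally have "a + k * x < k ^ Suc lx" by simp
    then show ?thesis using x a
      by (intro exI[of _ "a + k * x"] exI[of _ "Suc lx"]) (auto simp: steps_front)
  qed
  obtain X L where X: "L > 0" "X < k ^ L" "X mod k = a" "st q X L = q" using loop ab by blast
  obtain Y M where Y: "M > 0" "Y < k ^ M" "Y mod k = b" "st q Y M = q" using loop ab by blast
  have cat: "x + k ^ i * y < k ^ (i + j) \<and> (x + k ^ i * y) mod k = x mod k \<and> st q (x + k ^ i * y) (i + j) = q"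
    if "x < k ^ i" "y < k ^ j" "st q x i = q" "st q y j = q" "i > 0" for x y i j
  proof -
    have "x + k ^ i * y < k ^ i * Suc y" using that by simp
    also have "\<dots> \<le> k ^ i * k ^ j" using that by (intro mult_le_mono) auto
    finally have "x + k ^ i * y < k ^ (i + j)" by (simp add: power_add)
    moreover have "(x + k ^ i * y) mod k = x mod k"
      using \<open>i > 0\<close> by (cases i) (simp_all add: mult.assoc)
    ultimately show ?thesis using steps_append[of x i q y j] that by simp
  qed
  define B where "B = k ^ (L + M)"
  have B: "B \<ge> 2" unfolding B_def using k X(1) power_increasing[of 1 "L + M" k] by simp
  have XY: "X + k ^ L * Y < B" "(X + k ^ L * Y) mod k = a" "st q (X + k ^ L * Y) (L + M) = q"
    using cat[of X L Y M] X Y unfolding B_def by auto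
  have YX: "Y + k ^ M * X < B" "(Y + k ^ M * X) mod k = b" "st q (Y + k ^ M * X) (L + M) = q"
    using cat[of Y M X L] X Y unfolding B_def by (auto simp: add.commute)
  obtain p \<delta> where p: "p < B" "p + \<delta> < B" "st q p (L + M) = q" "st q (p + \<delta>) (L + M) = q" "\<delta> > 0"
  proof (cases "X + k ^ L * Y < Y + k ^ M * X")
    case True
    then show ?thesis using that[of "X + k ^ L * Y" "Y + k ^ M * X - (X + k ^ L * Y)"] XY YX by simp
  next
    case False
    then have "Y + k ^ M * X < X + k ^ L * Y" using ab XY YX by (metis nat_neq_iff)
    then show ?thesis using that[of "Y + k ^ M * X" "X + k ^ L * Y - (Y + k ^ M * X)"] XY YX by simp
  qed
  let ?A = "{z \<in> acc q. z > 0}"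
  have step: "p + B * z \<in> ?A \<and> (p + \<delta>) + B * z \<in> ?A" if "z \<in> ?A" for z
    using that p B k accepted_append[of p "L + M" z q] accepted_append[of "p + \<delta>" "L + M" z q]
    unfolding B_def by auto
  \<comment> \<open>Each of the \<open>B - 1\<close> summands has the prefix \<open>w\<close>, of
    length \<open>l\<close>, leading to the looping state, and then a number of the kind summed in
    \<open>two_digit_sums\<close>, whose formula has the extra \<open>p\<close> on the left.\<close>
  define E where "E n = (B - 1) * w + k ^ l * (B ^ n * ((B - 1) * v + p) - p)" for n
  show ?thesis
  proof (rule asymptotic_basis_if_progressions[OF cop])
    show "k ^ l * \<delta> > 0" using k p by simp
    show "E n \<le> ((B - 1) * w + k ^ l * ((B - 1) * v + p)) * B ^ n" for n
    proof -
      have "(B - 1) * w \<le> (B - 1) * w * B ^ n" using B by simp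
      then have "E n \<le> (B - 1) * w * B ^ n + k ^ l * (B ^ n * ((B - 1) * v + p))"
        unfolding E_def by (intro add_mono mult_le_mono2) auto
      then show ?thesis by (simp add: algebra_simps)
    qed
    show "sum_of_at_most (B - 1) (acc q0) (E n + (k ^ l * \<delta>) * m)" if m: "m < B ^ n" for n m
    proof -
      obtain xs where xs: "length xs = B - 1" "set xs \<subseteq> ?A"
        "sum_list xs + p = B ^ n * ((B - 1) * v + p) + \<delta> * m"
        using two_digit_sums[of B v ?A p \<delta>, OF B _ step m] v by blast
      let ?ys = "map (\<lambda>x. w + k ^ l * x) xs"
      have "set ?ys \<subseteq> acc q0" using xs accepted_append[OF w(1)] w by auto
      \<comment> \<open>Ensures that the truncated subtraction in \<open>E\<close> is exact.\<close>
      moreover have "p \<le> B ^ n * ((B - 1) * v + p)"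
        using B mult_le_mono[of 1 "B ^ n" p "(B - 1) * v + p"] by simp
      then have "sum_list xs = (B ^ n * ((B - 1) * v + p) - p) + \<delta> * m" using xs by linarith
      then have "sum_list ?ys = E n + (k ^ l * \<delta>) * m"
        unfolding sum_list_map_affine E_def xs(1) by (simp add: distrib_left mult.assoc)
      ultimately show ?thesis unfolding sum_of_at_most_def using xs
        by (intro exI[of _ ?ys]) simp
    qed
  qed (rule B)
qed

end

section \<open>A non-branching automaton accepts too few numbers\<close>

text \<open>Choosing \<open>l = 2 ^ (2 * u)\<close> reduces the claim to exponents: the polynomial
  side has an exponent linear in \<open>u\<close>, while \<open>l\<close> is at least the square of
  \<open>Suc u\<close>.\<close>

lemma exponential_beats_polynomial: "\<exists>l. a + (l * c + 2) ^ M < (2::nat) ^ l"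
proof -
  define C where "C = (c + 2) * M + a + 1"
  \<comment> \<open>Makes \<open>u * u = 2 * u * M + u * C\<close>, which already dominates the
    linear exponent; \<open>C\<close> collects its constant part.\<close>
  define u where "u = 2 * M + C"
  define l where "l = (2::nat) ^ (2 * u)"
  have "Suc u * Suc u \<le> 2 ^ u * 2 ^ u"
    by (intro mult_le_mono) (auto simp: Suc_le_eq less_exp)
  then have "Suc u * Suc u \<le> l" unfolding l_def by (simp add: power_add mult_2)
  moreover have "u * C \<ge> C" unfolding u_def C_def by simp
  then have "Suc u * Suc u \<ge> 2 * u * M + C" unfolding u_def by (simp add: algebra_simps)
  ultimately have l: "2 * u * M + C \<le> l" by simp
  have "l \<ge> 1" unfolding l_def by simp
  then have "l * c + 2 \<le> l * (c + 2)" by (simp add: distrib_left)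
  also have "\<dots> \<le> l * 2 ^ (c + 2)" using less_exp[of "c + 2"] by (intro mult_le_mono2) simp
  also have "\<dots> = 2 ^ (2 * u + (c + 2))" unfolding l_def by (simp add: power_add)
  finally have "(l * c + 2) ^ M \<le> (2 ^ (2 * u + (c + 2))) ^ M" by (rule power_mono) simp
  also have "\<dots> = 2 ^ ((2 * u + (c + 2)) * M)" by (simp only: power_mult)
  finally have "a + (l * c + 2) ^ M < 2 ^ a + 2 ^ ((2 * u + (c + 2)) * M)"
    using less_exp[of a] by (intro add_less_le_mono)
  also have "\<dots> \<le> 2 ^ (a + (2 * u + (c + 2)) * M) + 2 ^ (a + (2 * u + (c + 2)) * M)"
    by (intro add_mono power_increasing) auto
  also have "\<dots> = 2 ^ (a + (2 * u + (c + 2)) * M + 1)" by simp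
  also have "\<dots> \<le> 2 ^ l"
    using l unfolding C_def by (intro power_increasing) (auto simp: algebra_simps)
  finally show ?thesis by blast
qed

lemma eq_if_digits_eq:
  fixes k :: nat
  assumes "n < k ^ l" "n' < k ^ l" "\<And>i. i < l \<Longrightarrow> n div k ^ i mod k = n' div k ^ i mod k" "k > 0"
  shows "n = n'"
  using assms(1-3)
proof (induction l arbitrary: n n')
  case (Suc l)
  have "n div k = n' div k"
  proof (rule Suc.IH)
    show "n div k < k ^ l" "n' div k < k ^ l"
      using Suc.prems \<open>k > 0\<close> by (simp_all add: div_less_iff_less_mult mult.commute)
    show "n div k div k ^ i mod k = n' div k div k ^ i mod k" if "i < l" for i
      using Suc.prems(3)[of "Suc i"] that by (simp add: div_mult2_eq)
  qed
  moreover have "n mod k = n' mod k" using Suc.prems(3)[of 0] by simp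
  ultimately show ?case by (metis mult_div_mod_eq)
qed simp

lemma card_sum_of_at_most:
  fixes S :: "nat set"
  shows "card {n. n < N \<and> sum_of_at_most j S n} \<le> card {n \<in> insert 0 S. n < N} ^ j"
proof (induction j)
  case 0
  show ?case by (rule order_trans[OF card_mono[of "{0}"]]) auto
next
  case (Suc j)
  let ?A = "{n \<in> insert 0 S. n < N}" and ?B = "{n. n < N \<and> sum_of_at_most j S n}"
  have "{n. n < N \<and> sum_of_at_most (Suc j) S n} \<subseteq> (\<lambda>(x, y). x + y) ` (?A \<times> ?B)"
  proof
    fix n assume "n \<in> {n. n < N \<and> sum_of_at_most (Suc j) S n}"
    then obtain x y where "x \<in> insert 0 S" "sum_of_at_most j S y" "n = x + y" "n < N"
      unfolding sum_of_at_most_Suc by blast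
    then show "n \<in> (\<lambda>(x, y). x + y) ` (?A \<times> ?B)" by (intro image_eqI[of _ _ "(x, y)"]) auto
  qed
  then have "card {n. n < N \<and> sum_of_at_most (Suc j) S n} \<le> card (?A \<times> ?B)"
    by (rule surj_card_le[rotated]) simp
  also have "\<dots> \<le> card ?A * card ?A ^ j"
    unfolding card_cartesian_product by (intro mult_le_mono2 Suc.IH)
  finally show ?case by simp
qed

context digit_automaton
begin

lemma steps_mod: "st q (n mod k ^ l) l = st q n l"
  using steps_append[of "n mod k ^ l" l q "n div k ^ l" 0] k by simp

lemma steps_add: "st q n (i + m) = st (st q n i) (n div k ^ i) m"
  using steps_append[of "n mod k ^ i" i q "n div k ^ i" m] k by (simp add: steps_mod)

lemma reachable_steps: "reachable q (st q n l)"
  unfolding reachable_def using k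
  by (intro exI[of _ l] exI[of _ "n mod k ^ l"]) (simp add: steps_mod)

section \<open>Polynomial growth in the non-branching case\<close>

context
  fixes q0 :: nat
  assumes q0: "q0 < s" and nb: "\<not> branching q0"
begin

text \<open>The second visit closes a loop that starts with the digit read at the first. Both visits
  precede the end of the expansion, so the unread digits form a positive number and \<open>q\<close>
  is live.\<close>

lemma revisit:
  assumes n: "n \<in> acc q0" and i: "i < i'" "i' < ndigits k n" "st q0 n i = q" "st q0 n i' = q"
  shows "q < s" "reachable q0 q" "live q" "reachable (d q (n div k ^ i mod k)) q"
proof -
  show "q < s" using steps_less q0 i by blast
  show "reachable q0 q" using reachable_steps i by blast
  have v: "n div k ^ i > 0"
    using i ndigits_le_iff[of n i] k by (simp add: div_greater_zero_iff)
  then have "n div k ^ i \<in> acc (st q0 (n mod k ^ i) i)"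
    using accepted_append[of "n mod k ^ i" i "n div k ^ i" q0] n k by simp
  then show "live q" unfolding live_def using v i by (auto simp: steps_mod)
  obtain m where m: "i' = i + Suc m" using i less_imp_Suc_add by auto
  have "st (d q (n div k ^ i mod k)) (n div k ^ i div k) m = q"
    using i steps_add[of q0 n i "Suc m"] unfolding m by (simp add: steps_front)
  then show "reachable (d q (n div k ^ i mod k)) q" using reachable_steps by metis
qed

text \<open>An accepted number is determined by the position and digit of the last visit to each state:
  at every earlier visit, the digit read is the only one that leads back.\<close>

definition last_visit :: "nat \<Rightarrow> nat \<Rightarrow> (nat \<times> nat) set" where
  "last_visit n q = {(i, n div k ^ i mod k) | i. i < ndigits k n \<and> st q0 n i = q \<and>
     (\<forall>i'. i < i' \<longrightarrow> i' < ndigits k n \<longrightarrow> st q0 n i' \<noteq> q)}"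

lemma last_visit_inj:
  assumes n: "n \<in> acc q0" "ndigits k n = l" "n' \<in> acc q0" "ndigits k n' = l"
    and eq: "\<And>q. q < s \<Longrightarrow> last_visit n q = last_visit n' q"
  shows "n = n'"
proof (rule eq_if_digits_eq)
  show "n < k ^ l" "n' < k ^ l" using n ndigits_le_iff by (metis order_refl)+
  \<comment> \<open>If position \<open>i\<close> is the recorded last visit to the common state, the
    record contains the digit. Otherwise both numbers return to that state later, and two different
    digits would make the automaton branch.\<close>
  have step: "n div k ^ i mod k = n' div k ^ i mod k" if i: "i < l" "st q0 n i = st q0 n' i" for i
  proof -
    define q where "q = st q0 n i"
    have q: "st q0 n i = q" "st q0 n' i = q" "q < s" using i steps_less q0 unfolding q_def by auto
    show ?thesis
    proof (cases "\<exists>u. (i, u) \<in> last_visit n q")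
      case True
      then have "(i, n div k ^ i mod k) \<in> last_visit n q" unfolding last_visit_def by auto
      then show ?thesis unfolding eq[OF q(3)] by (auto simp: last_visit_def)
    next
      case False
      then have "(i, n div k ^ i mod k) \<notin> last_visit n q" "(i, n' div k ^ i mod k) \<notin> last_visit n' q"
        using eq[OF q(3)] by auto
      then obtain i1 i2 where "i < i1" "i1 < l" "st q0 n i1 = q" "i < i2" "i2 < l" "st q0 n' i2 = q"
        using n i q unfolding last_visit_def by auto
      then have r: "reachable q0 q" "live q"
        "reachable (d q (n div k ^ i mod k)) q" "reachable (d q (n' div k ^ i mod k)) q"
        using revisit[OF n(1), of i i1 q] revisit[OF n(3), of i i2 q] n q by auto
      then show ?thesis using nb q k unfolding branching_def
        by (metis mod_less_divisor not_numeral_le_zero zero_less_iff_neq_zero)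
    qed
  qed
  \<comment> \<open>The runs are rebuilt from the lowest digit upwards, each equal state forcing the
    next digit and hence the next state.\<close>
  have "st q0 n i = st q0 n' i" if "i \<le> l" for i
    using that by (induction i) (auto simp: steps_Suc step)
  then show "n div k ^ i mod k = n' div k ^ i mod k" if "i < l" for i
    using step that by simp
qed (use k in simp)

text \<open>For each of the \<open>s\<close> states the record is empty or a single pair, out of
  \<open>l * k\<close> pairs of a position and a digit.\<close>

lemma card_accepted_ndigits: 
  "finite {n \<in> acc q0. ndigits k n = l}" "card {n \<in> acc q0. ndigits k n = l} \<le> (l * k + 1) ^ s"
proof -
  let ?X = "{n \<in> acc q0. ndigits k n = l}"
  let ?T = "insert {} ((\<lambda>p. {p}) ` ({..<l} \<times> {..<k}))"
  have "?X \<subseteq> {..<k ^ l}" using ndigits_le_iff by auto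
  then show fin: "finite ?X" by (rule finite_subset) simp
  have "card ?T \<le> Suc (card ((\<lambda>p. {p}) ` ({..<l} \<times> {..<k})))" by (rule card_insert_le_m1) auto
  also have "card ((\<lambda>p. {p}) ` ({..<l} \<times> {..<k})) \<le> card ({..<l} \<times> {..<k})" by (rule card_image_le) simp
  finally have T: "card ?T \<le> l * k + 1" by simp
  have "card ?X \<le> card ({..<s} \<rightarrow>\<^sub>E ?T)"
  proof (rule card_inj_on_le)
    show "inj_on (\<lambda>n. restrict (last_visit n) {..<s}) ?X"
    proof (rule inj_onI)
      fix n n' assume n: "n \<in> ?X" "n' \<in> ?X"
        and eq: "restrict (last_visit n) {..<s} = restrict (last_visit n') {..<s}"
      have "last_visit n q = last_visit n' q" if "q < s" for q
        using fun_cong[OF eq, of q] that by simp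
      then show "n = n'" using last_visit_inj[of n l n'] n by simp
    qed
    show "(\<lambda>n. restrict (last_visit n) {..<s}) ` ?X \<subseteq> {..<s} \<rightarrow>\<^sub>E ?T"
    proof (intro image_subsetI restrict_PiE)
      fix n assume n: "n \<in> ?X"
      show "restrict (last_visit n) {..<s} \<in> {..<s} \<rightarrow>\<^sub>E ?T"
      proof (rule restrict_PiE_iff[THEN iffD2], intro ballI)
        fix q
        show "last_visit n q \<in> ?T"
        proof (cases "last_visit n q = {}")
          case False
          then obtain i where i: "i < l" "(i, n div k ^ i mod k) \<in> last_visit n q"
            using n unfolding last_visit_def by auto
          have "p = (i, n div k ^ i mod k)" if "p \<in> last_visit n q" for p
          proof -
            obtain i' where i': "p = (i', n div k ^ i' mod k)" "i' < ndigits k n" "st q0 n i' = q"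
              "\<forall>j>i'. j < ndigits k n \<longrightarrow> st q0 n j \<noteq> q"
              using \<open>p \<in> last_visit n q\<close> unfolding last_visit_def by blast
            have "i < ndigits k n" "st q0 n i = q" "\<forall>j>i. j < ndigits k n \<longrightarrow> st q0 n j \<noteq> q"
              using i unfolding last_visit_def by auto
            then have "i = i'" using i' by (metis nat_neq_iff)
            then show ?thesis using i' by simp
          qed
          then have "last_visit n q = {(i, n div k ^ i mod k)}" using i by blast
          moreover have "n div k ^ i mod k < k" using k by simp
          ultimately show ?thesis using i by blast
        qed simp
      qed
    qed
    show "finite ({..<s} \<rightarrow>\<^sub>E ?T)" by (intro finite_PiE) auto
  qed
  also have "\<dots> = card ?T ^ s" by (simp add: card_PiE)
  also have "\<dots> \<le> (l * k + 1) ^ s" using T by (rule power_mono) simp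
  finally show "card ?X \<le> (l * k + 1) ^ s" .
qed

lemma card_accepted_less: "card {n \<in> insert 0 (acc q0). n < k ^ l} \<le> (l * k + 2) ^ Suc s"
proof -
  let ?X = "\<lambda>l. {n \<in> acc q0. ndigits k n = l}"
  have "{n \<in> insert 0 (acc q0). n < k ^ l} \<subseteq> insert 0 (\<Union>l'\<le>l. ?X l')"
    using ndigits_le_iff by auto
  then have "card {n \<in> insert 0 (acc q0). n < k ^ l} \<le> card (insert 0 (\<Union>l'\<le>l. ?X l'))"
    by (intro card_mono finite.insertI finite_UN_I card_accepted_ndigits) auto
  also have "\<dots> \<le> Suc (card (\<Union>l'\<le>l. ?X l'))" by (rule card_insert_le_m1) auto
  also have "card (\<Union>l'\<le>l. ?X l') \<le> (\<Sum>l'\<le>l. card (?X l'))" by (rule card_UN_le) simp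
  also have "\<dots> \<le> (\<Sum>l'\<le>l. (l * k + 1) ^ s)"
    by (intro sum_mono order_trans[OF card_accepted_ndigits(2)] power_mono) auto
  also have "\<dots> = (l + 1) * (l * k + 1) ^ s" by simp
  \<comment> \<open>The slack between \<open>l * k + 1\<close> and \<open>l * k + 2\<close> absorbs
    the additional element \<open>0\<close> in the next step.\<close>
  also have "\<dots> \<le> (l * k + 1) * (l * k + 2) ^ s" using k by (intro mult_le_mono power_mono) auto
  also have "Suc \<dots> \<le> (l * k + 2) ^ Suc s" by simp
  finally show ?thesis by simp
qed

lemma not_asymptotic_basis_if_not_branching: "\<not> asymptotic_additive_basis (acc q0)"
proof
  assume "asymptotic_additive_basis (acc q0)"
  then obtain j N where N: "\<And>n. n \<ge> N \<Longrightarrow> sum_of_at_most j (acc q0) n"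
    unfolding asymptotic_additive_basis_def asymptotic_additive_basis_of_order_def by blast
  \<comment> \<open>With polynomially many summands below \<open>k ^ l\<close>, the sums of
    \<open>j\<close> of them are too few to cover all numbers from \<open>N\<close> to
    \<open>k ^ l\<close>.\<close>
  obtain l where l: "N + (l * k + 2) ^ (Suc s * j) < 2 ^ l"
    using exponential_beats_polynomial by blast
  have "k ^ l - N = card {N..<k ^ l}" by simp
  also have "\<dots> \<le> card {n. n < k ^ l \<and> sum_of_at_most j (acc q0) n}"
    using N by (intro card_mono) auto
  also have "\<dots> \<le> card {n \<in> insert 0 (acc q0). n < k ^ l} ^ j" by (rule card_sum_of_at_most)
  also have "\<dots> \<le> ((l * k + 2) ^ Suc s) ^ j" by (intro power_mono card_accepted_less) simp
  also have "\<dots> = (l * k + 2) ^ (Suc s * j)" by (simp only: power_mult)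
  finally have "k ^ l \<le> N + (l * k + 2) ^ (Suc s * j)" by simp
  moreover have "2 ^ l \<le> k ^ l" using k by (intro power_mono) auto
  ultimately show False using l by simp
qed

end

end

section \<open>Decoding automata\<close>

text \<open>A nonempty list has the code \<open>Suc (prod_encode (x, list_encode xs))\<close>, hence
  the predecessor. On \<open>0\<close>, the code of the empty list, head and tail are both
  \<open>0\<close>.\<close>

definition code_hd :: "nat \<Rightarrow> nat" where
  "code_hd c = fst (prod_decode (c - 1))"

definition code_drop :: "nat \<Rightarrow> nat \<Rightarrow> nat" where
  "code_drop c i = rec_nat c (\<lambda>_ r. snd (prod_decode (r - 1))) i"

definition code_nth :: "nat \<Rightarrow> nat \<Rightarrow> nat" where
  "code_nth c i = code_hd (code_drop c i)"

text \<open>Such bounds have two uses: they confine the decoded states to \<open>{..e}\<close>, and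
  they bound the inner quantifier when \<open>prod_encode\<close> is inverted by search.\<close>

lemma code_hd_le: "code_hd c \<le> c"
  unfolding code_hd_def
  by (metis diff_le_self le_prod_encode_1 le_trans prod.collapse prod_decode_inverse)

lemma code_tl_le: "snd (prod_decode (c - 1)) \<le> c"
  by (metis diff_le_self le_prod_encode_2 le_trans prod.collapse prod_decode_inverse)

lemma code_drop_le: "code_drop c i \<le> c"
proof (induction i)
  case (Suc i)
  then show ?case using code_tl_le[of "code_drop c i"] unfolding code_drop_def by simp
qed (simp add: code_drop_def)

lemma code_nth_le: "code_nth c i \<le> c"
  unfolding code_nth_def using code_hd_le code_drop_le le_trans by blast

lemma code_drop_list_encode: "code_drop (list_encode xs) i = list_encode (drop i xs)"
proof (induction i)
  case (Suc i)
  have "snd (prod_decode (list_encode ys - 1)) = list_encode (tl ys)" for ys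
  proof (cases ys)
    case Nil
    have "prod_encode (0, 0) = 0" by (simp add: prod_encode_def)
    then show ?thesis using Nil prod_encode_inverse by (metis diff_0_eq_0 list.sel(2) list_encode.simps(1) snd_conv)
  qed simp
  with Suc show ?case by (simp add: code_drop_def drop_Suc tl_drop)
qed (simp add: code_drop_def)

lemma code_nth_list_encode: "i < length xs \<Longrightarrow> code_nth (list_encode xs) i = xs ! i"
  unfolding code_nth_def code_drop_list_encode
  by (simp add: code_hd_def Cons_nth_drop_Suc[symmetric])

lemma length_le_list_encode: "length xs \<le> list_encode xs"
proof (induction xs)
  case (Cons x xs)
  then show ?case using le_prod_encode_2[of "list_encode xs" x] by simp
qed simp

text \<open>Every number \<open>e\<close> is read as an automaton with states \<open>0, \<dots>, e\<close>, so that no input is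
  malformed.\<close>

definition dfa_start :: "nat \<Rightarrow> nat" where
  "dfa_start e = code_nth e 0"

definition dfa_step :: "nat \<Rightarrow> nat \<Rightarrow> nat \<Rightarrow> nat" where
  "dfa_step e q a = code_nth (code_nth (code_nth e 1) q) a"

text \<open>A nonzero remaining code says that position \<open>i\<close> lies inside the list; the
  code of a list bounds its length, so the search misses no entry.\<close>

definition dfa_final :: "nat \<Rightarrow> nat \<Rightarrow> bool" where
  "dfa_final e q \<longleftrightarrow> (\<exists>i<code_nth e 2. code_drop (code_nth e 2) i \<noteq> 0 \<and> code_nth (code_nth e 2) i = q)"

definition dfa_set :: "nat \<Rightarrow> nat \<Rightarrow> nat set" where
  "dfa_set k e = accepted k (dfa_step e) (dfa_final e) (dfa_start e)"

lemma dfa_start_le: "dfa_start e \<le> e"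
  unfolding dfa_start_def by (rule code_nth_le)

lemma dfa_step_le: "dfa_step e q a \<le> e"
  unfolding dfa_step_def using code_nth_le[of "code_nth (code_nth e 1) q" a]
    code_nth_le[of "code_nth e 1" q] code_nth_le[of e 1] by linarith

lemma digit_automaton_dfa: "k \<ge> 2 \<Longrightarrow> digit_automaton k (Suc e) (dfa_step e)"
  by standard (auto simp: less_Suc_eq_le dfa_step_le)

lemma dfa_start_encode: "dfa_start (encode_dfa M) = start M"
  by (simp add: dfa_start_def encode_dfa_def code_nth_list_encode del: list_encode.simps)

lemma dfa_final_encode: "dfa_final (encode_dfa M) q \<longleftrightarrow> q \<in> set (finals M)"
proof -
  have "code_nth (encode_dfa M) 2 = list_encode (finals M)"
    by (simp add: encode_dfa_def code_nth_list_encode del: list_encode.simps)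
  moreover have "0 < list_encode ys \<longleftrightarrow> ys \<noteq> []" for ys by (cases ys) auto
  ultimately have "dfa_final (encode_dfa M) q \<longleftrightarrow>
      (\<exists>i<list_encode (finals M). i < length (finals M) \<and> finals M ! i = q)"
    unfolding dfa_final_def by (auto simp: code_drop_list_encode code_nth_list_encode)
  then show ?thesis
    using length_le_list_encode[of "finals M"] by (auto simp: in_set_conv_nth)
qed

lemma dfa_step_encode:
  assumes "wf_dfa k M" "q < length (table M)" "a < k"
  shows "dfa_step (encode_dfa M) q a = table M ! q ! a"
proof -
  have "code_nth (encode_dfa M) 1 = list_encode (map list_encode (table M))"
    by (simp add: encode_dfa_def code_nth_list_encode del: list_encode.simps)
  moreover have "length (table M ! q) = k" using assms unfolding wf_dfa_def by simp
  ultimately show ?thesis using assms by (simp add: dfa_step_def code_nth_list_encode)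
qed

lemma foldl_table:
  assumes wf: "wf_dfa k M" and "k \<ge> 2" and "q < length (table M)" "set w \<subseteq> {..<k}"
  shows "foldl (\<lambda>q a. table M ! q ! a) q w =
    steps k (dfa_step (encode_dfa M)) q (horner_sum id k w) (length w)"
  using assms(3,4)
proof (induction w arbitrary: q)
  case (Cons a w)
  have a: "a < k" using Cons.prems by simp
  have "length (table M ! q) = k" "set (table M ! q) \<subseteq> {..<length (table M)}"
    using wf Cons.prems(1) unfolding wf_dfa_def by auto
  then have "table M ! q ! a < length (table M)" using a nth_mem by fastforce
  moreover have "(a + k * horner_sum id k w) mod k = a" "(a + k * horner_sum id k w) div k = horner_sum id k w"
    using a by simp_all
  ultimately show ?case
    using Cons a dfa_step_encode[OF wf Cons.prems(1) a] by (simp add: steps_front)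
qed simp

context digit_automaton
begin

lemma canonical_expansion_length:
  "canonical_expansion k n w \<Longrightarrow> length w = ndigits k n \<and> (w \<noteq> [] \<longrightarrow> n > 0)"
proof (induction w arbitrary: n)
  case (Cons a w)
  define n' where "n' = horner_sum id k w"
  have n: "n = a + k * n'" "a < k" and c: "canonical_expansion k n' w"
    using Cons.prems unfolding canonical_expansion_def n'_def by (auto split: if_splits)
  have IH: "length w = ndigits k n'" "w \<noteq> [] \<longrightarrow> n' > 0" using Cons.IH[OF c] by auto
  have "n > 0"
  proof (cases w)
    case Nil
    then show ?thesis using Cons.prems n unfolding canonical_expansion_def by simp
  qed (use IH n k in auto)
  moreover have "n div k = n'" using n by simp
  ultimately show ?case using IH by (simp add: ndigits_pos)
qed (simp add: canonical_expansion_def)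

lemma ex_canonical_expansion: "\<exists>w. canonical_expansion k n w"
proof (induction n rule: less_induct)
  case (less n)
  show ?case
  proof (cases "n = 0")
    case True
    then show ?thesis by (intro exI[of _ "[]"]) (simp add: canonical_expansion_def)
  next
    case False
    then obtain w where w: "canonical_expansion k (n div k) w" using less[of "n div k"] k by auto
    have "w = [] \<Longrightarrow> n mod k \<noteq> 0"
      using w False unfolding canonical_expansion_def by (auto simp: mod_eq_0_iff_dvd dvd_def)
    then show ?thesis using w k
      by (intro exI[of _ "n mod k # w"]) (auto simp: canonical_expansion_def)
  qed
qed

end

lemma dfa_set_encode:
  assumes k: "k \<ge> 2" and acc: "accepts_set k M S"
  shows "dfa_set k (encode_dfa M) = S"
proof (rule set_eqI)
  fix n
  interpret digit_automaton k "Suc (encode_dfa M)" "dfa_step (encode_dfa M)" "dfa_final (encode_dfa M)"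
    by (rule digit_automaton_dfa[OF k])
  obtain w where w: "canonical_expansion k n w" using ex_canonical_expansion by blast
  have wf: "wf_dfa k M" using acc unfolding accepts_set_def by simp
  have "n \<in> dfa_set k (encode_dfa M) \<longleftrightarrow> run M w \<in> set (finals M)"
    using canonical_expansion_length[OF w] w foldl_table[OF wf k, of "start M" w] wf
    unfolding dfa_set_def accepted_def run_def canonical_expansion_def wf_dfa_def
    by (simp add: dfa_final_encode dfa_start_encode)
  also have "\<dots> \<longleftrightarrow> w \<in> language k M"
    using w unfolding language_def canonical_expansion_def by simp
  also have "\<dots> \<longleftrightarrow> n \<in> S"
    using acc w unfolding accepts_set_def canonical_expansion_def by auto
  finally show "n \<in> dfa_set k (encode_dfa M) \<longleftrightarrow> n \<in> S" .
qed


section \<open>Computability of the tests\<close>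

text \<open>Since \<open>prod_encode\<close> is given by an arithmetic formula, searching for its
  arguments shows that decoding is recursive.\<close>

lemma code_hd_Least: "code_hd c = (LEAST x. \<exists>y<Suc c. prod_encode (x, y) = c - 1)"
  and ex_code_hd: "\<exists>x. \<exists>y<Suc c. prod_encode (x, y) = c - 1"
  and code_tl_Least: "snd (prod_decode (c - 1)) = (LEAST y. \<exists>x<Suc c. prod_encode (x, y) = c - 1)"
  and ex_code_tl: "\<exists>y. \<exists>x<Suc c. prod_encode (x, y) = c - 1"
proof -
  obtain u v where uv: "prod_decode (c - 1) = (u, v)" by fastforce
  then have e: "prod_encode (x, y) = c - 1 \<longleftrightarrow> x = u \<and> y = v" for x y
    by (metis prod.inject prod_decode_inverse prod_encode_inverse)
  have le: "u < Suc c" "v < Suc c"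
    using code_hd_le[of c] code_tl_le[of c] uv by (auto simp: code_hd_def)
  show "code_hd c = (LEAST x. \<exists>y<Suc c. prod_encode (x, y) = c - 1)"
    using uv le unfolding e by (auto simp: code_hd_def intro!: Least_equality[symmetric])
  show "snd (prod_decode (c - 1)) = (LEAST y. \<exists>x<Suc c. prod_encode (x, y) = c - 1)"
    using uv le unfolding e by (auto intro!: Least_equality[symmetric])
  show "\<exists>x. \<exists>y<Suc c. prod_encode (x, y) = c - 1" "\<exists>y. \<exists>x<Suc c. prod_encode (x, y) = c - 1"
    using le unfolding e by auto
qed

lemma rec_fun_prod_encode [rec_intros]:
  assumes "rec_fun n f" "rec_fun n g"
  shows "rec_fun n (\<lambda>xs. prod_encode (f xs, g xs))"
  unfolding prod_encode_def triangle_def prod.case by (intro rec_intros assms)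

lemma rec_fun_code_hd [rec_intros]:
  assumes "rec_fun n f" shows "rec_fun n (\<lambda>xs. code_hd (f xs))"
  unfolding code_hd_Least
  by (rule rec_fun_Least) (intro rec_intros rec_fun_tl assms, rule ex_code_hd)

lemma rec_fun_code_tl:
  assumes "rec_fun n f" shows "rec_fun n (\<lambda>xs. snd (prod_decode (f xs - 1)))"
  unfolding code_tl_Least
  by (rule rec_fun_Least) (intro rec_intros rec_fun_tl assms, rule ex_code_tl)

lemma rec_fun_code_drop [rec_intros]:
  assumes "rec_fun n f" "rec_fun n g" shows "rec_fun n (\<lambda>xs. code_drop (f xs) (g xs))"
  unfolding code_drop_def
  by (intro rec_fun_rec_nat rec_fun_code_tl rec_fun_tl rec_fun_hd assms)

lemma rec_fun_code_nth [rec_intros]: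
  assumes "rec_fun n f" "rec_fun n g" shows "rec_fun n (\<lambda>xs. code_nth (f xs) (g xs))"
  unfolding code_nth_def by (intro rec_intros assms)

lemma rec_fun_dfa_start [rec_intros]:
  assumes "rec_fun n e" shows "rec_fun n (\<lambda>xs. dfa_start (e xs))"
  unfolding dfa_start_def by (intro rec_intros assms)

lemma rec_fun_dfa_step [rec_intros]:
  assumes "rec_fun n e" "rec_fun n q" "rec_fun n a"
  shows "rec_fun n (\<lambda>xs. dfa_step (e xs) (q xs) (a xs))"
  unfolding dfa_step_def by (intro rec_intros assms)

lemma dec_pred_dfa_final [rec_intros]:
  assumes "rec_fun n e" "rec_fun n q"
  shows "dec_pred n (\<lambda>xs. dfa_final (e xs) (q xs))"
  unfolding dfa_final_def by (intro rec_intros rec_fun_tl assms)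

lemma rec_fun_steps [rec_intros]:
  assumes "rec_fun n e" "rec_fun n q" "rec_fun n m" "rec_fun n l"
  shows "rec_fun n (\<lambda>xs. steps k (dfa_step (e xs)) (q xs) (m xs) (l xs))"
  unfolding steps_def by (intro rec_fun_rec_nat rec_intros rec_fun_tl assms)

lemma rec_fun_sum_states [rec_intros]:
  assumes "rec_fun n s" "rec_fun n j"
  shows "rec_fun n (\<lambda>xs. sum_states (s xs) (j xs))"
proof -
  have "sum_states s j = rec_nat 2 (\<lambda>_ r. 2 ^ (2 * (2 * s) * r)) j" for s j
    by (induction j) auto
  then show ?thesis
    by (simp only:) (intro rec_fun_rec_nat rec_intros rec_fun_tl assms)
qed

context
  fixes k :: nat
  assumes k: "k \<ge> 2"
begin

lemma rec_fun_ndigits [rec_intros]: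
  assumes "rec_fun n f" shows "rec_fun n (\<lambda>xs. ndigits k (f xs))"
  unfolding ndigits_def
proof (rule rec_fun_Least)
  show "\<exists>l. f xs < k ^ l" for xs
    using k by (intro exI[of _ "f xs"] power_gt_expt) simp
qed (intro rec_intros rec_fun_tl assms)

lemma dec_pred_dfa_set [rec_intros]:
  assumes "rec_fun n e" "rec_fun n f" shows "dec_pred n (\<lambda>xs. f xs \<in> dfa_set k (e xs))"
  unfolding dfa_set_def accepted_def mem_Collect_eq by (intro rec_intros assms)

lemma dec_pred_sum_of_at_most [rec_intros]:
  assumes "rec_fun n e" "rec_fun n j" "rec_fun n f"
  shows "dec_pred n (\<lambda>xs. sum_of_at_most (j xs) (dfa_set k (e xs)) (f xs))"
  unfolding sum_of_at_most_iff_digits insert_iff by (intro rec_intros rec_fun_tl assms)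

lemma dec_pred_branching:
  assumes "rec_fun n e"
  shows "dec_pred n (\<lambda>xs. digit_automaton.branching k (Suc (e xs)) (dfa_step (e xs)) (dfa_final (e xs)) (dfa_start (e xs)))"
proof -
  \<comment> \<open>Reachability with the path length bounded by the square of the number
    \<open>Suc e\<close> of states; all quantifiers in the branching condition become
    bounded.\<close>
  define R where "R e q q' \<longleftrightarrow> (\<exists>l<Suc (Suc e * Suc e). \<exists>w<k ^ l. steps k (dfa_step e) q w l = q')" for e q q'
  have [rec_intros]: "dec_pred n (\<lambda>xs. R (e xs) (q xs) (q' xs))"
    if "rec_fun n e" "rec_fun n q" "rec_fun n q'" for n e q q'
    unfolding R_def by (intro rec_intros rec_fun_tl that)
  have eq: "digit_automaton.branching k (Suc e) (dfa_step e) (dfa_final e) (dfa_start e) \<longleftrightarrow>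
     (\<exists>q<Suc e. R e (dfa_start e) q \<and> (\<exists>q'<Suc e. R e q q' \<and> (\<exists>a<k. 0 < a \<and> dfa_final e (dfa_step e q' a))) \<and>
        (\<exists>a<k. \<exists>b<k. a \<noteq> b \<and> R e (dfa_step e q a) q \<and> R e (dfa_step e q b) q))" for e
  proof -
    interpret digit_automaton k "Suc e" "dfa_step e" "dfa_final e"
      by (rule digit_automaton_dfa[OF k])
    have "reachable q q' \<longleftrightarrow> R e q q'" if "q < Suc e" for q q'
      unfolding R_def using reachable_bounded[OF that] .
    then show ?thesis
      unfolding branching_def using live_iff step_less dfa_start_le[of e]
      by (intro ex_cong1 conj_cong refl) (simp_all add: less_Suc_eq_le)
  qed
  show ?thesis unfolding eq by (intro rec_intros rec_fun_tl assms)
qed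

end

section \<open>The decision procedure\<close>

lemma additive_basis_of_order_imp_asymptotic:
  "additive_basis_of_order j S \<Longrightarrow> asymptotic_additive_basis_of_order j S"
  unfolding additive_basis_of_order_def asymptotic_additive_basis_of_order_def by blast

lemma one_mem_if_sum_of_at_most: "sum_of_at_most j S 1 \<Longrightarrow> 1 \<in> S"
proof -
  have "sum_list xs = 1 \<Longrightarrow> 1 \<in> set xs" for xs :: "nat list"
    by (induction xs) (auto simp: add_is_1)
  then show "sum_of_at_most j S 1 \<Longrightarrow> 1 \<in> S" unfolding sum_of_at_most_def by blast
qed

text \<open>The number \<open>1\<close> is a sum only if it is itself a summand. Conversely, with
  \<open>1\<close> available, each of the finitely many exceptions \<open>n < N\<close> is a sum of
  \<open>n\<close> ones.\<close>

lemma additive_basis_iff_asymptotic: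
  "additive_basis S \<longleftrightarrow> asymptotic_additive_basis S \<and> 1 \<in> S"
proof
  assume "additive_basis S"
  then show "asymptotic_additive_basis S \<and> 1 \<in> S"
    unfolding additive_basis_def asymptotic_additive_basis_def
    using additive_basis_of_order_imp_asymptotic one_mem_if_sum_of_at_most
    by (metis additive_basis_of_order_def)
next
  assume *: "asymptotic_additive_basis S \<and> 1 \<in> S"
  then obtain j N where N: "\<And>n. n \<ge> N \<Longrightarrow> sum_of_at_most j S n"
    unfolding asymptotic_additive_basis_def asymptotic_additive_basis_of_order_def by blast
  have "sum_of_at_most (max j N) S n" for n
  proof (cases "n \<ge> N")
    case True
    then show ?thesis using N sum_of_at_most_mono max.cobounded1 by blast
  next
    case False
    have "sum_of_at_most n S n" using sum_of_at_most_mult[OF sum_of_at_most_1, of 1 S n] * by simp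
    then show ?thesis by (rule sum_of_at_most_mono) (use False in simp)
  qed
  then show "additive_basis S" unfolding additive_basis_def additive_basis_of_order_def by blast
qed

lemma no_common_divisor_if_asymptotic_basis:
  assumes "asymptotic_additive_basis S" "c \<ge> 2" shows "\<not> (\<forall>n\<in>S. c dvd n)"
proof
  assume c: "\<forall>n\<in>S. c dvd n"
  obtain j N where N: "\<And>n. n \<ge> N \<Longrightarrow> sum_of_at_most j S n"
    using assms unfolding asymptotic_additive_basis_def asymptotic_additive_basis_of_order_def by blast
  then have "c dvd N" "c dvd N + 1" using dvd_sum_of_at_most[OF c] le_add1 by blast+
  then have "c dvd 1" using dvd_add_right_iff by blast
  then show False using assms by simp
qed

text \<open>One variable runs through candidate orders and candidate witnesses at once. Assumption
  \<open>ex\<close> says that exactly one kind occurs: hence the search always ends, and when an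
  order exists no witness can interrupt it before the least one.\<close>

lemma computable_order_search:
  fixes check stop :: "nat \<Rightarrow> nat \<Rightarrow> bool"
  assumes check: "dec_pred (Suc (Suc 0)) (\<lambda>ys. check (hd (tl ys)) (hd ys))"
    and stop: "dec_pred (Suc (Suc 0)) (\<lambda>ys. stop (hd (tl ys)) (hd ys))"
    and ex: "\<And>e. (\<exists>j. check e j) \<longleftrightarrow> \<not> (\<exists>y. stop e y)"
  shows "\<exists>f. computable f \<and> (\<forall>e. f e = (if \<exists>j. check e j then Suc (LEAST j. check e j) else 0))"
proof -
  let ?L = "\<lambda>e. LEAST y. check e y \<or> stop e y"
  let ?f = "\<lambda>e. if check e (?L e) then Suc (?L e) else 0"
  have L: "rec_fun (Suc 0) (\<lambda>xs. ?L (hd xs))"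
    by (rule rec_fun_Least) (intro rec_intros check stop, use ex in blast)
  have "rec_fun (Suc 0) (\<lambda>xs. of_bool (check (hd xs) (?L (hd xs))))"
  proof -
    have "rec_fun (length [\<lambda>xs. ?L (hd xs), hd]) (\<lambda>ys. of_bool (check (hd (tl ys)) (hd ys)))"
      using rec_fun_of_bool[OF check] by simp
    from rec_fun_comp[OF this, of "Suc 0"] L rec_fun_hd show ?thesis by auto
  qed
  then have "computable ?f"
    using L by (intro computableI rec_fun_if rec_fun_Suc rec_fun_const) (simp_all add: dec_pred_def)
  moreover have "?f e = (if \<exists>j. check e j then Suc (LEAST j. check e j) else 0)" for e
  proof (cases "\<exists>j. check e j")
    case True
    then have "?L e = (LEAST j. check e j)" using ex by metis
    then show ?thesis using True LeastI_ex[OF True] by simp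
  qed auto
  ultimately show ?thesis by blast
qed

theorem mainTheorem5:
  fixes k :: nat
  assumes "k \<ge> 2"
  shows
    "(\<exists>f. computable f \<and>
        (\<forall>M S. accepts_set k M S \<longrightarrow>
          f (encode_dfa M) =
            (if asymptotic_additive_basis S
             then Suc (LEAST j. asymptotic_additive_basis_of_order j S)
             else 0)))
     \<and>
     (\<exists>f. computable f \<and>
        (\<forall>M S. accepts_set k M S \<longrightarrow>
          f (encode_dfa M) =
            (if additive_basis S
             then Suc (LEAST j. additive_basis_of_order j S)
             else 0)))"
proof -
  let ?S = "dfa_set k"
  define branch where "branch e \<longleftrightarrow>
    digit_automaton.branching k (Suc e) (dfa_step e) (dfa_final e) (dfa_start e)" for e
  have branch: "dec_pred n (\<lambda>xs. branch (e xs))" if "rec_fun n e" for n e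
    unfolding branch_def by (rule dec_pred_branching[OF assms that])
  \<comment> \<open>These facts are needed for every number \<open>e\<close>, not only for codes of
    automata, because the search must end on all inputs.\<close>
  have order:
    "asymptotic_additive_basis_of_order j (?S e) \<longleftrightarrow>
      (\<forall>n<k ^ (2 * sum_states (Suc e) j). k ^ sum_states (Suc e) j \<le> n \<longrightarrow> sum_of_at_most j (?S e) n)"
    "additive_basis_of_order j (?S e) \<longleftrightarrow> (\<forall>n<k ^ sum_states (Suc e) j. sum_of_at_most j (?S e) n)"
    and dvd: "c \<ge> 2 \<Longrightarrow> (\<forall>n\<in>?S e. c dvd n) \<longleftrightarrow>
      (\<forall>n<k ^ (2 * Suc e * c * c). n \<in> ?S e \<longrightarrow> c dvd n)"
    and basis_iff: "asymptotic_additive_basis (?S e) \<longleftrightarrow> \<not> (\<not> branch e \<or> (\<exists>c\<ge>2. \<forall>n\<in>?S e. c dvd n))"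
    for e j c
  proof -
    interpret digit_automaton k "Suc e" "dfa_step e" "dfa_final e"
      by (rule digit_automaton_dfa[OF assms])
    have start: "dfa_start e < Suc e" using dfa_start_le by (simp add: less_Suc_eq_le)
    show "asymptotic_additive_basis_of_order j (?S e) \<longleftrightarrow>
      (\<forall>n<k ^ (2 * sum_states (Suc e) j). k ^ sum_states (Suc e) j \<le> n \<longrightarrow> sum_of_at_most j (?S e) n)"
      "additive_basis_of_order j (?S e) \<longleftrightarrow> (\<forall>n<k ^ sum_states (Suc e) j. sum_of_at_most j (?S e) n)"
      unfolding dfa_set_def by (rule asymptotic_order_iff[OF start] order_iff[OF start])+
    show "c \<ge> 2 \<Longrightarrow> (\<forall>n\<in>?S e. c dvd n) \<longleftrightarrow>
      (\<forall>n<k ^ (2 * Suc e * c * c). n \<in> ?S e \<longrightarrow> c dvd n)"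
      unfolding dfa_set_def by (rule all_dvd_iff[OF start])
    show "asymptotic_additive_basis (?S e) \<longleftrightarrow> \<not> (\<not> branch e \<or> (\<exists>c\<ge>2. \<forall>n\<in>?S e. c dvd n))"
      using asymptotic_basis_if_branching[of "dfa_start e"] no_common_divisor_if_asymptotic_basis
        not_asymptotic_basis_if_not_branching[OF start]
      unfolding branch_def dfa_set_def by blast
  qed

  have "\<exists>f. computable f \<and> (\<forall>e. f e =
     (if \<exists>j. asymptotic_additive_basis_of_order j (?S e)
      then Suc (LEAST j. asymptotic_additive_basis_of_order j (?S e)) else 0))"
  proof (rule computable_order_search)
    \<comment> \<open>The search variable is read as a candidate common divisor; without branching,
      the search stops at once.\<close>
    let ?stop = "\<lambda>e c. \<not> branch e \<or>
      2 \<le> c \<and> (\<forall>n<k ^ (2 * Suc e * c * c). n \<in> ?S e \<longrightarrow> c dvd n)"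
    show "dec_pred (Suc (Suc 0)) (\<lambda>ys. asymptotic_additive_basis_of_order (hd ys) (?S (hd (tl ys))))"
      unfolding order by (intro rec_intros dec_pred_sum_of_at_most[OF assms] rec_fun_tl)
    show "dec_pred (Suc (Suc 0)) (\<lambda>ys. ?stop (hd (tl ys)) (hd ys))"
      by (intro rec_intros branch dec_pred_dfa_set[OF assms] rec_fun_tl)
    show "(\<exists>j. asymptotic_additive_basis_of_order j (?S e)) \<longleftrightarrow> \<not> (\<exists>c. ?stop e c)" for e
      using basis_iff[of e] dvd[of _ e] unfolding asymptotic_additive_basis_def by blast
  qed
  then obtain f where f: "computable f" "\<And>e. f e =
     (if \<exists>j. asymptotic_additive_basis_of_order j (?S e)
      then Suc (LEAST j. asymptotic_additive_basis_of_order j (?S e)) else 0)"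
    by blast
  have "\<exists>f. computable f \<and> (\<forall>e. f e =
     (if \<exists>j. additive_basis_of_order j (?S e)
      then Suc (LEAST j. additive_basis_of_order j (?S e)) else 0))"
  proof (rule computable_order_search)
    \<comment> \<open>No divisor is searched for here: if \<open>1\<close> belongs to the set, no
      \<open>c \<ge> 2\<close> divides all its elements.\<close>
    let ?stop = "\<lambda>e c::nat. \<not> branch e \<or> 1 \<notin> ?S e"
    show "dec_pred (Suc (Suc 0)) (\<lambda>ys. additive_basis_of_order (hd ys) (?S (hd (tl ys))))"
      unfolding order by (intro rec_intros dec_pred_sum_of_at_most[OF assms] rec_fun_tl)
    show "dec_pred (Suc (Suc 0)) (\<lambda>ys. ?stop (hd (tl ys)) (hd ys))"
      by (intro rec_intros branch dec_pred_dfa_set[OF assms] rec_fun_tl)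
    have "\<not> (\<forall>n\<in>?S e. c dvd n)" if "1 \<in> ?S e" "c \<ge> 2" for e c
      using that by fastforce
    then show "(\<exists>j. additive_basis_of_order j (?S e)) \<longleftrightarrow> \<not> (\<exists>c. ?stop e c)" for e
      using basis_iff[of e] additive_basis_iff_asymptotic[of "?S e"]
      unfolding additive_basis_def by blast
  qed
  then obtain g where g: "computable g" "\<And>e. g e =
     (if \<exists>j. additive_basis_of_order j (?S e)
      then Suc (LEAST j. additive_basis_of_order j (?S e)) else 0)"
    by blast
  show ?thesis
    unfolding asymptotic_additive_basis_def additive_basis_def
    using f g dfa_set_encode[OF assms] by (intro conjI exI[of _ f] exI[of _ g]) simp_all
qed

end
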